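(* Let $\mathcal{F}$ be the collection of triples $(f,\eta,\mathbb{P}_N)$ satisfying the Problem Assumptions (P1)–(P4) in the context, where $\mathbb{P}_N$ is the joint distribution of the noise $W_1,\dots,W_N$. Then, with $\mathbf{X}$ a test point of density $f$ independent of the data and the infimum over all estimators $\hat\eta$ (measurable functions of the observed data $(\mathbf{X}_i,Y_i)_{i=1}^N$), $$\inf_{\hat{\eta}}\sup_{(f,\eta,\mathbb{P}_N)\in \mathcal{F}}\mathbb{E}\left[\sup_{\mathcal{A}}\left(\hat{\eta}(\mathbf{X}) - \eta(\mathbf{X})\right)^2 \right]\gtrsim \left(\frac{q}{N}\right)^{\frac{d+2}{d+1}} + N^{-\frac{2}{d+2}},$$ and $$\inf_{\hat{\eta}}\sup_{(f,\eta,\mathbb{P}_N)\in \mathcal{F}}\mathbb{E}\left[\sup_{\mathcal{A}}\sup_{\mathbf{x}}|\hat{\eta}(\mathbf{x})-\eta(\mathbf{x})|\right]\gtrsim \left(\frac{q}{N}\right)^{\frac{1}{d+1}}+N^{-\frac{1}{d+2}}.$$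
   Context: Model. Fix a norm $\|\cdot\|$ on $\mathbb{R}^d$; $v_d$ is the volume of its unit ball and $B(\mathbf{x},r)$ the ball of radius $r$ about $\mathbf{x}$. Training inputs $\mathbf{X}_1,\dots,\mathbf{X}_N$ are i.i.d. with density $f$; noise variables $W_1,\dots,W_N$ are independent with zero mean and finite variance. There is a set $\mathcal{B}\subset\{1,\dots,N\}$ of attacked indices with $|\mathcal{B}|\le q$; observed labels are $Y_i=\eta(\mathbf{X}_i)+W_i$ for $i\notin\mathcal{B}$ and arbitrary values chosen by an adversary for $i\in\mathcal{B}$. The adversary knows $\eta$, all $\mathbf{X}_i,W_i$, and the estimator; an attack strategy $\mathcal{A}$ is a (possibly randomized) choice of $\mathcal{B}$ and the corrupted values, and $\sup_{\mathcal{A}}$ is the supremum over all of them. Problem Assumptions: there are a compact set $\mathcal{X}$ and constants $L,\gamma,f_m,f_M,D,\alpha,\sigma,M>0$ such that $f$ is supported on $\mathcal{X}$ and (P1) $|\eta(\mathbf{x}_1)-\eta(\mathbf{x}_2)|\le L\|\mathbf{x}_1-\mathbf{x}_2\|$ on $\mathcal{X}$; (P2) $f_m\le f\le f_M$ and $|\eta|\le M$ on $\mathcal{X}$; (P3) $\mathrm{Vol}(B(\mathbf{x},r)\cap\mathcal{X})\ge\alpha v_d r^d$ for $r<D$, $\mathbf{x}\in\mathcal{X}$; (P4) $\mathbb{E}[e^{\lambda W_i}]\le e^{\sigma^2\lambda^2/2}$ for $|\lambda|\le1/\sigma$. Notation: $a\gtrsim b$ means $a\ge cb$ for a constant $c>0$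 depending only on the constants above (and $d$). *)

theory Defs
  imports "HOL-Probability.Probability"
begin

definition is_norm :: "('a::euclidean_space \<Rightarrow> real) \<Rightarrow> bool" where
  "is_norm n \<longleftrightarrow> (\<forall>x. n x = 0 \<longleftrightarrow> x = 0) \<and> (\<forall>x y. n (x + y) \<le> n x + n y)
     \<and> (\<forall>c x. n (c *\<^sub>R x) = \<bar>c\<bar> * n x)"

definition nball :: "('a::euclidean_space \<Rightarrow> real) \<Rightarrow> 'a \<Rightarrow> real \<Rightarrow> 'a set" where
  "nball n x r = {y. n (y - x) < r}"

definition vd :: "('a::euclidean_space \<Rightarrow> real) \<Rightarrow> real" where
  "vd n = measure lborel (nball n 0 1)"

definition regular_domain :: "('a::euclidean_space \<Rightarrow> real) \<Rightarrow> 'a set \<Rightarrow> real \<Rightarrow> real \<Rightarrow> bool" where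
  "regular_domain n X \<alpha> D \<longleftrightarrow> (\<forall>x\<in>X. \<forall>r. 0 < r \<and> r < D \<longrightarrow>
      emeasure lborel (nball n x r \<inter> X) \<ge> ennreal (\<alpha> * vd n * r ^ DIM('a)))"

text \<open>Membership of a triple (f, eta, mu) in the class F (for sample size N); the joint noise
  law is P_N = PiM {..<N} mu (independent noise variables W_i with laws mu i).\<close>
definition in_class ::
  "('a::euclidean_space \<Rightarrow> real) \<Rightarrow> 'a set \<Rightarrow> real \<Rightarrow> real \<Rightarrow> real \<Rightarrow> real \<Rightarrow> real \<Rightarrow> nat
   \<Rightarrow> ('a \<Rightarrow> real) \<Rightarrow> ('a \<Rightarrow> real) \<Rightarrow> (nat \<Rightarrow> real measure) \<Rightarrow> bool" where
  "in_class n X L fm fM M \<sigma> N f \<eta> \<mu> \<longleftrightarrow>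
     f \<in> borel_measurable lborel \<and> (\<forall>x. 0 \<le> f x) \<and> (\<forall>x. x \<notin> X \<longrightarrow> f x = 0)
     \<and> (\<integral>\<^sup>+ x. ennreal (f x) \<partial>lborel) = 1
     \<and> (\<forall>x1\<in>X. \<forall>x2\<in>X. \<bar>\<eta> x1 - \<eta> x2\<bar> \<le> L * n (x1 - x2))
     \<and> (\<forall>x\<in>X. fm \<le> f x \<and> f x \<le> fM) \<and> (\<forall>x\<in>X. \<bar>\<eta> x\<bar> \<le> M)
     \<and> (\<forall>i<N. prob_space (\<mu> i) \<and> sets (\<mu> i) = sets borel
          \<and> integrable (\<mu> i) (\<lambda>w. w) \<and> integrable (\<mu> i) (\<lambda>w. w\<^sup>2)
          \<and> (\<integral> w. w \<partial>\<mu> i) = 0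
          \<and> (\<forall>s. \<bar>s\<bar> \<le> 1 / \<sigma> \<longrightarrow>
               (\<integral>\<^sup>+ w. ennreal (exp (s * w)) \<partial>\<mu> i) \<le> ennreal (exp (\<sigma>\<^sup>2 * s\<^sup>2 / 2))))"

text \<open>Probability space of (test point X, training inputs X_i, noises W_i), all independent.\<close>
definition sample_space :: "('a::euclidean_space \<Rightarrow> real) \<Rightarrow> (nat \<Rightarrow> real measure) \<Rightarrow> nat
    \<Rightarrow> ('a \<times> (nat \<Rightarrow> 'a) \<times> (nat \<Rightarrow> real)) measure" where
  "sample_space f \<mu> N = density lborel (\<lambda>x. ennreal (f x)) \<Otimes>\<^sub>M
      (PiM {..<N} (\<lambda>_. density lborel (\<lambda>x. ennreal (f x))) \<Otimes>\<^sub>M PiM {..<N} \<mu>)"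

definition obs :: "('a \<Rightarrow> real) \<Rightarrow> nat \<Rightarrow> (nat \<Rightarrow> 'a) \<Rightarrow> (nat \<Rightarrow> real) \<Rightarrow> nat set
    \<Rightarrow> (nat \<Rightarrow> real) \<Rightarrow> (nat \<Rightarrow> 'a \<times> real)" where
  "obs \<eta> N Xs Ws B z = (\<lambda>i\<in>{..<N}. (Xs i, if i \<in> B then z i else \<eta> (Xs i) + Ws i))"

definition attacks :: "nat \<Rightarrow> nat \<Rightarrow> (nat set \<times> (nat \<Rightarrow> real)) set" where
  "attacks N q = {(B, z). B \<subseteq> {..<N} \<and> card B \<le> q}"

definition is_estimator :: "nat \<Rightarrow> ((nat \<Rightarrow> 'a::euclidean_space \<times> real) \<Rightarrow> 'a \<Rightarrow> real) \<Rightarrow> bool" where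
  "is_estimator N e \<longleftrightarrow>
     (\<lambda>(D, x). e D x) \<in> borel_measurable (PiM {..<N} (\<lambda>_. borel) \<Otimes>\<^sub>M borel)"

definition pt_risk :: "((nat \<Rightarrow> 'a \<times> real) \<Rightarrow> 'a \<Rightarrow> real) \<Rightarrow> ('a \<Rightarrow> real) \<Rightarrow> nat \<Rightarrow> nat
    \<Rightarrow> 'a \<times> (nat \<Rightarrow> 'a) \<times> (nat \<Rightarrow> real) \<Rightarrow> ennreal" where
  "pt_risk e \<eta> N q \<omega> = (case \<omega> of (x, Xs, Ws) \<Rightarrow>
     (SUP A\<in>attacks N q. ennreal ((e (obs \<eta> N Xs Ws (fst A) (snd A)) x - \<eta> x)\<^sup>2)))"

definition sup_risk :: "((nat \<Rightarrow> 'a \<times> real) \<Rightarrow> 'a \<Rightarrow> real) \<Rightarrow> ('a \<Rightarrow> real) \<Rightarrow> 'a set \<Rightarrow> nat \<Rightarrow> nat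
    \<Rightarrow> 'a \<times> (nat \<Rightarrow> 'a) \<times> (nat \<Rightarrow> real) \<Rightarrow> ennreal" where
  "sup_risk e \<eta> X N q \<omega> = (case \<omega> of (x, Xs, Ws) \<Rightarrow>
     (SUP A\<in>attacks N q. SUP x'\<in>X. ennreal \<bar>e (obs \<eta> N Xs Ws (fst A) (snd A)) x' - \<eta> x'\<bar>))"

end

theory Submission
  imports Defs
begin

text \<open>
  Inputs are uniform on \<open>X\<close>. The regression functions are those of Assouad's hypercube: on every
  cell of a grid of width \<open>h\<close> put a bump of height of order \<open>h\<close> with an arbitrary sign. At a test
  point \<open>x\<close>, the function \<open>\<eta>\<close> and the function obtained by flipping the sign on the cell of \<open>x\<close>
  differ by order \<open>h\<close>, and only the labels of inputs in that cell can tell them apart; averaging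
  over all signs turns this two-point problem into a lower bound for the worst-case risk.

  Without attack, take Gaussian noise: about \<open>N h^d\<close> labels are shifted by at most order \<open>h\<close>,
  so the two hypotheses stay indistinguishable as long as \<open>N h^(d+2)\<close> is small.

  With attack, take noise uniform on an interval. Shifting the labels in the cell by the gap between
  the two functions and wrapping around the ends of the interval changes the law under one hypothesis
  exactly into the law under the other one, and the adversary has to alter only the labels that wrap
  around. Their expected number is of order \<open>N h^(d+1)\<close>, so the attack is feasible, by
  Markov's inequality with probability at least one half, when \<open>h\<close> is a small multiple of
  \<open>(q/N)^(1/(d+1))\<close>. The adversary knows the test point, so this even gives the rate
  \<open>(q/N)^(2/(d+1))\<close> for the squared error, which dominates \<open>(q/N)^((d+2)/(d+1))\<close>.
\<close>

subsection \<open>Noise laws\<close>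

text \<open>Fubini peels off one coordinate at a time, so a change of variables \<open>T i\<close>
  with weight \<open>\<rho> i\<close> in every factor becomes one on the product, weighted by the
  product. It serves the Gaussian shifts, where the weights are likelihood ratios, and the
  rotations, where they are 1.\<close>

lemma nn_integral_PiM_componentwise:
  assumes "product_sigma_finite M" "finite I"
    and [measurable]: "\<And>i. T i \<in> M i \<rightarrow>\<^sub>M M i" "\<And>i. \<rho> i \<in> borel_measurable (M i)"
    and one: "\<And>i f. f \<in> borel_measurable (M i) \<Longrightarrow>
      (\<integral>\<^sup>+ w. f (T i w) \<partial>M i) = (\<integral>\<^sup>+ w. f w * \<rho> i w \<partial>M i)"
    and "F \<in> borel_measurable (PiM I M)"
  shows "(\<integral>\<^sup>+ w. F (\<lambda>i\<in>I. T i (w i)) \<partial>PiM I M) = (\<integral>\<^sup>+ w. F w * (\<Prod>i\<in>I. \<rho> i (w i)) \<partial>PiM I M)"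
  using assms(2,6)
proof (induction I arbitrary: F rule: finite_induct)
  case empty
  then show ?case by (simp add: PiM_empty nn_integral_count_space_finite)
next
  case (insert i I)
  interpret product_sigma_finite M by fact
  interpret Mi: sigma_finite_measure "M i" by (rule sigma_finite_measures)
  interpret PI: sigma_finite_measure "PiM I M" by (rule sigma_finite) fact
  interpret PP: pair_sigma_finite "PiM I M" "M i" ..
  note [measurable] = insert.prems
  have upd: "(\<lambda>j\<in>insert i I. T j ((x(i := y)) j)) = (\<lambda>j\<in>I. T j (x j))(i := T i y)" for x y
    using insert.hyps by (auto simp: fun_eq_iff)
  have [measurable]: "(\<lambda>w. \<lambda>j\<in>insert i I. T j (w j)) \<in> PiM (insert i I) M \<rightarrow>\<^sub>M PiM (insert i I) M"
    by measurable
  have [measurable]: "(\<lambda>w. \<lambda>j\<in>I. T j (w j)) \<in> PiM I M \<rightarrow>\<^sub>M PiM I M"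
    by measurable
  have meas: "(\<lambda>(x, y). F (x(i := y))) \<in> borel_measurable (PiM I M \<Otimes>\<^sub>M M i)"
    by measurable
  have slice: "(\<lambda>y. F (x(i := y))) \<in> borel_measurable (M i)" if "x \<in> space (PiM I M)" for x
    using measurable_compose_Pair1[OF that meas] by simp
  have prod: "(\<Prod>j\<in>insert i I. \<rho> j ((x(i := y)) j)) = \<rho> i y * (\<Prod>j\<in>I. \<rho> j (x j))" for x y
  proof -
    have "(\<Prod>j\<in>I. \<rho> j ((x(i := y)) j)) = (\<Prod>j\<in>I. \<rho> j (x j))"
      using insert.hyps by (intro prod.cong) auto
    then show ?thesis using insert.hyps by simp
  qed
  have "(\<integral>\<^sup>+ w. F (\<lambda>j\<in>insert i I. T j (w j)) \<partial>PiM (insert i I) M)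
      = (\<integral>\<^sup>+ x. (\<integral>\<^sup>+ y. F ((\<lambda>j\<in>I. T j (x j))(i := T i y)) \<partial>M i) \<partial>PiM I M)"
    unfolding upd[symmetric] by (rule product_nn_integral_insert[OF insert.hyps]) measurable
  also have "\<dots> = (\<integral>\<^sup>+ x. (\<integral>\<^sup>+ y. F ((\<lambda>j\<in>I. T j (x j))(i := y)) * \<rho> i y \<partial>M i) \<partial>PiM I M)"
  proof (rule nn_integral_cong)
    fix x assume "x \<in> space (PiM I M)"
    then have "(\<lambda>j\<in>I. T j (x j)) \<in> space (PiM I M)"
      by (auto intro: measurable_space[OF \<open>(\<lambda>w. \<lambda>j\<in>I. T j (w j)) \<in> _\<close>])
    from one[OF slice[OF this]]
    show "(\<integral>\<^sup>+ y. F ((\<lambda>j\<in>I. T j (x j))(i := T i y)) \<partial>M i)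
        = (\<integral>\<^sup>+ y. F ((\<lambda>j\<in>I. T j (x j))(i := y)) * \<rho> i y \<partial>M i)" .
  qed
  \<comment> \<open>The induction hypothesis is applied to the integral over coordinate
    \<open>i\<close>, already weighted by \<open>\<rho> i\<close>; this is why the induction runs
    over arbitrary \<open>F\<close>.\<close>
  also have "\<dots> = (\<integral>\<^sup>+ x. (\<integral>\<^sup>+ y. F (x(i := y)) * \<rho> i y \<partial>M i) * (\<Prod>j\<in>I. \<rho> j (x j)) \<partial>PiM I M)"
    by (rule insert.IH[where F="\<lambda>x. \<integral>\<^sup>+ y. F (x(i := y)) * \<rho> i y \<partial>M i"]) measurable
  also have "\<dots> = (\<integral>\<^sup>+ x. (\<integral>\<^sup>+ y. F (x(i := y)) * (\<Prod>j\<in>insert i I. \<rho> j ((x(i := y)) j)) \<partial>M i) \<partial>PiM I M)"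
    unfolding prod mult.assoc[symmetric]
    by (intro nn_integral_cong nn_integral_multc[symmetric] borel_measurable_times slice) auto
  also have "\<dots> = (\<integral>\<^sup>+ w. F w * (\<Prod>j\<in>insert i I. \<rho> j (w j)) \<partial>PiM (insert i I) M)"
    by (rule product_nn_integral_insert[OF insert.hyps, symmetric]) measurable
  finally show ?case .
qed

text \<open>The demands of \<open>in_class\<close> on a single noise law, isolated so that the
  Gaussian and the uniform construction enter the class in the same way.\<close>

definition subgaussian_noise :: "real \<Rightarrow> real measure \<Rightarrow> bool" where
  "subgaussian_noise \<sigma> \<gamma> \<longleftrightarrow> prob_space \<gamma> \<and> sets \<gamma> = sets borel
     \<and> integrable \<gamma> (\<lambda>w. w) \<and> integrable \<gamma> (\<lambda>w. w\<^sup>2) \<and> (\<integral> w. w \<partial>\<gamma>) = 0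
     \<and> (\<forall>s. \<bar>s\<bar> \<le> 1 / \<sigma> \<longrightarrow> (\<integral>\<^sup>+ w. ennreal (exp (s * w)) \<partial>\<gamma>) \<le> ennreal (exp (\<sigma>\<^sup>2 * s\<^sup>2 / 2)))"

section \<open>Gaussian noise and uniform noise on an interval\<close>

definition gauss :: "real \<Rightarrow> real measure" where
  "gauss \<sigma> = density lborel (\<lambda>w. ennreal (normal_density 0 \<sigma> w))"

definition unif :: "real \<Rightarrow> real measure" where
  "unif a = density lborel (\<lambda>w. ennreal (indicator {-a..<a} w / (2 * a)))"

lemma sets_gauss [measurable_cong, simp]: "sets (gauss \<sigma>) = sets borel"
  by (simp add: gauss_def)

lemma sets_unif [measurable_cong, simp]: "sets (unif a) = sets borel"
  by (simp add: unif_def)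

lemma space_gauss [simp]: "space (gauss \<sigma>) = UNIV"
  by (simp add: gauss_def)

lemma space_unif [simp]: "space (unif a) = UNIV"
  by (simp add: unif_def)

text \<open>The weight is the likelihood ratio of the normal law with mean \<open>v\<close> against
  the centred one; it appears on moving the translation from \<open>f\<close> to the
  density.\<close>

lemma nn_integral_gauss_shift:
  assumes "0 < \<sigma>" and [measurable]: "f \<in> borel_measurable borel"
  shows "(\<integral>\<^sup>+ w. f (v + w) \<partial>gauss \<sigma>)
    = (\<integral>\<^sup>+ w. f w * ennreal (exp (v * w / \<sigma>\<^sup>2 - v\<^sup>2 / (2 * \<sigma>\<^sup>2))) \<partial>gauss \<sigma>)"
proof -
  have dens: "normal_density 0 \<sigma> (w - v)
      = normal_density 0 \<sigma> w * exp (v * w / \<sigma>\<^sup>2 - v\<^sup>2 / (2 * \<sigma>\<^sup>2))" for w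
    using assms(1)
    by (simp add: normal_density_def exp_add[symmetric] power2_diff diff_divide_distrib add_divide_distrib)
  have "(\<integral>\<^sup>+ w. f (v + w) \<partial>gauss \<sigma>) = (\<integral>\<^sup>+ w. ennreal (normal_density 0 \<sigma> w) * f (v + w) \<partial>lborel)"
    unfolding gauss_def by (subst nn_integral_density) auto
  also have "\<dots> = (\<integral>\<^sup>+ w. ennreal (normal_density 0 \<sigma> (w - v)) * f w \<partial>lborel)"
    by (subst nn_integral_real_affine[where c=1 and t=v]) auto
  also have "\<dots> = (\<integral>\<^sup>+ w. ennreal (normal_density 0 \<sigma> w) *
      (f w * ennreal (exp (v * w / \<sigma>\<^sup>2 - v\<^sup>2 / (2 * \<sigma>\<^sup>2)))) \<partial>lborel)"
    unfolding dens by (intro nn_integral_cong) (simp add: ennreal_mult mult_ac)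
  also have "\<dots> = (\<integral>\<^sup>+ w. f w * ennreal (exp (v * w / \<sigma>\<^sup>2 - v\<^sup>2 / (2 * \<sigma>\<^sup>2))) \<partial>gauss \<sigma>)"
    unfolding gauss_def by (subst nn_integral_density) auto
  finally show ?thesis .
qed

lemma subgaussian_noise_gauss:
  assumes "0 < \<sigma>"
  shows "subgaussian_noise \<sigma> (gauss \<sigma>)"
proof -
  interpret prob_space "gauss \<sigma>"
    unfolding gauss_def using assms by (rule prob_space_normal_density)
  have "integrable (gauss \<sigma>) (\<lambda>w. w)" "(\<integral> w. w \<partial>gauss \<sigma>) = 0"
    using normal_moment_nz_1[OF assms, of 0]
    by (auto simp: gauss_def integrable_density integral_density has_bochner_integral_iff)
  moreover have "integrable (gauss \<sigma>) (\<lambda>w. w\<^sup>2)"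
    using integrable_normal_moment[OF assms, of 0 2]
    by (auto simp: gauss_def integrable_density)
  moreover have "(\<integral>\<^sup>+ w. ennreal (exp (s * w)) \<partial>gauss \<sigma>) = ennreal (exp (\<sigma>\<^sup>2 * s\<^sup>2 / 2))" for s
  proof -
    \<comment> \<open>For this \<open>v\<close> the likelihood ratio of the shift equals
      \<open>exp (s * w)\<close> up to the factor
      \<open>exp (\<sigma>\<^sup>2 * s\<^sup>2 / 2)\<close>; its total mass 1 then yields the moment
      generating function exactly.\<close>
    let ?v = "\<sigma>\<^sup>2 * s"
    have eq: "exp (s * w) = exp (\<sigma>\<^sup>2 * s\<^sup>2 / 2) * exp (?v * w / \<sigma>\<^sup>2 - ?v\<^sup>2 / (2 * \<sigma>\<^sup>2))" for w
      using assms by (simp add: exp_add[symmetric] power2_eq_square field_simps)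
    have "(\<integral>\<^sup>+ w. ennreal (exp (s * w)) \<partial>gauss \<sigma>) = ennreal (exp (\<sigma>\<^sup>2 * s\<^sup>2 / 2)) *
        (\<integral>\<^sup>+ w. 1 * ennreal (exp (?v * w / \<sigma>\<^sup>2 - ?v\<^sup>2 / (2 * \<sigma>\<^sup>2))) \<partial>gauss \<sigma>)"
      unfolding eq by (subst nn_integral_cmult[symmetric]) (auto simp: ennreal_mult)
    also have "\<dots> = ennreal (exp (\<sigma>\<^sup>2 * s\<^sup>2 / 2))"
      using nn_integral_gauss_shift[OF assms, of "\<lambda>_. 1" ?v] emeasure_space_1 by simp
    finally show ?thesis .
  qed
  ultimately show ?thesis
    unfolding subgaussian_noise_def using prob_space_axioms by simp
qed

lemma prob_space_unif:
  assumes "0 < a"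
  shows "prob_space (unif a)"
proof
  have "emeasure (unif a) (space (unif a)) = (\<integral>\<^sup>+ w. ennreal (1 / (2 * a)) * indicator {-a..<a} w \<partial>lborel)"
    unfolding unif_def by (subst emeasure_density) (auto intro!: nn_integral_cong simp: indicator_def)
  also have "\<dots> = 1"
    using assms by (subst nn_integral_cmult_indicator) (auto simp: ennreal_mult[symmetric])
  finally show "emeasure (unif a) (space (unif a)) = 1" .
qed

lemma AE_unif: "AE w in unif a. -a \<le> w \<and> w < a"
  unfolding unif_def by (subst AE_density) (auto simp: indicator_def)

lemma integral_unif_id:
  assumes "0 < a"
  shows "(\<integral> w. w \<partial>unif a) = 0"
proof -
  let ?g = "\<lambda>w. indicator {-a..<a} w / (2 * a) * w"
  have "(\<integral> w. w \<partial>unif a) = (\<integral> w. ?g w \<partial>lborel)"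
    unfolding unif_def using assms by (subst integral_density) auto
  also have "\<dots> = (\<integral> w. ?g (- w) \<partial>lborel)"
    using lborel_integral_real_affine[of "-1" ?g 0] by simp
  \<comment> \<open>The half-open interval is symmetric about 0 only up to its two endpoints, a null
    set.\<close>
  also have "\<dots> = (\<integral> w. - ?g w \<partial>lborel)"
    using AE_lborel_singleton[of a] AE_lborel_singleton[of "-a"]
    by (intro integral_cong_AE) (auto simp: indicator_def elim!: AE_mp)
  finally have "(\<integral> w. w \<partial>unif a) = - (\<integral> w. w \<partial>unif a)"
    unfolding unif_def using assms by (subst integral_density) auto
  then show ?thesis by simp
qed

text \<open>Half-width \<open>\<sigma> / 2\<close> gives
  \<open>\<bar>s * w\<bar> \<le> 1 / 2\<close> for all admissible \<open>s\<close>, where the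
  exponential lies below \<open>1 + u + u\<^sup>2\<close>. The mean kills the linear term, and
  \<open>1 + s\<^sup>2 * a\<^sup>2\<close> is absorbed into an exponential with a quarter of
  \<open>\<sigma>\<^sup>2 * s\<^sup>2\<close> in the exponent.\<close>

lemma subgaussian_noise_unif:
  assumes "0 < \<sigma>"
  shows "subgaussian_noise \<sigma> (unif (\<sigma> / 2))"
proof -
  define a where "a = \<sigma> / 2"
  have a: "0 < a" using assms by (simp add: a_def)
  interpret prob_space "unif a" by (rule prob_space_unif) fact
  have AE: "AE w in unif a. \<bar>w\<bar> \<le> a"
    using AE_unif[of a] by eventually_elim auto
  have int1: "integrable (unif a) (\<lambda>w. w)"
    by (rule integrable_const_bound[OF AE[folded real_norm_def]]) auto
  have "AE w in unif a. norm (w\<^sup>2) \<le> a\<^sup>2"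
    using AE by eventually_elim (auto simp: abs_le_square_iff[symmetric])
  then have int2: "integrable (unif a) (\<lambda>w. w\<^sup>2)"
    by (rule integrable_const_bound) auto
  have "(\<integral>\<^sup>+ w. ennreal (exp (s * w)) \<partial>unif a) \<le> ennreal (exp (\<sigma>\<^sup>2 * s\<^sup>2 / 2))"
    if s: "\<bar>s\<bar> \<le> 1 / \<sigma>" for s
  proof -
    have bnd: "exp (s * w) \<le> 1 + s * w + s\<^sup>2 * a\<^sup>2 \<and> 0 \<le> 1 + s * w + s\<^sup>2 * a\<^sup>2" if "\<bar>w\<bar> \<le> a" for w
    proof -
      have "\<bar>s * w\<bar> \<le> 1 / \<sigma> * a"
        unfolding abs_mult using s that assms by (intro mult_mono) auto
      then have sw: "\<bar>s * w\<bar> \<le> 1 / 2" using assms by (simp add: a_def)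
      have "exp (s * w) \<le> 1 + s * w + (s * w)\<^sup>2"
      proof (cases "0 \<le> s * w")
        case True
        then show ?thesis using sw by (intro exp_bound) auto
      next
        case False
        define t where "t = - (s * w)"
        have t: "0 < t" "t \<le> 1/2" using False sw by (auto simp: t_def)
        have "exp (-t) \<le> 1 / (1 + t)"
          using t exp_ge_add_one_self[of t] by (auto simp: exp_minus field_simps)
        also have "\<dots> \<le> 1 - t + t\<^sup>2"
        proof -
          \<comment> \<open>The product is \<open>1 + t ^ 3\<close>.\<close>
          have "1 \<le> (1 - t + t\<^sup>2) * (1 + t)"
            using t by (simp add: algebra_simps power2_eq_square)
          then show ?thesis using t by (simp add: divide_le_eq)
        qed
        finally show ?thesis by (simp add: t_def)
      qed
      moreover have "(s * w)\<^sup>2 \<le> s\<^sup>2 * a\<^sup>2"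
        unfolding power_mult_distrib using that a
        by (intro mult_left_mono) (auto simp: abs_le_square_iff[symmetric])
      ultimately show ?thesis using sw by (auto simp: abs_le_iff)
    qed
    have "(\<integral>\<^sup>+ w. ennreal (exp (s * w)) \<partial>unif a) \<le> (\<integral>\<^sup>+ w. ennreal (1 + s * w + s\<^sup>2 * a\<^sup>2) \<partial>unif a)"
      using AE by (intro nn_integral_mono_AE, eventually_elim) (auto intro!: ennreal_leI bnd[THEN conjunct1])
    also have "\<dots> = ennreal (\<integral> w. 1 + s * w + s\<^sup>2 * a\<^sup>2 \<partial>unif a)"
      using AE int1 by (intro nn_integral_eq_integral) (auto simp: bnd elim!: AE_mp)
    also have "(\<integral> w. 1 + s * w + s\<^sup>2 * a\<^sup>2 \<partial>unif a) = 1 + s\<^sup>2 * a\<^sup>2"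
      using int1 integral_unif_id[OF a] by (simp add: prob_space[simplified])
    also have "1 + s\<^sup>2 * a\<^sup>2 \<le> exp (s\<^sup>2 * a\<^sup>2)" by (rule exp_ge_add_one_self)
    also have "s\<^sup>2 * a\<^sup>2 \<le> \<sigma>\<^sup>2 * s\<^sup>2 / 2" by (auto simp: a_def power_divide)
    finally show ?thesis by (simp add: ennreal_leI)
  qed
  then show ?thesis
    unfolding subgaussian_noise_def
    using int1 int2 prob_space_axioms integral_unif_id[OF a] by (simp add: a_def)
qed

section \<open>Translation of uniform noise with wrap-around\<close>

definition rot :: "real \<Rightarrow> real \<Rightarrow> real \<Rightarrow> real" where
  "rot a s w = (if a \<le> s + w then s + w - 2 * a else if s + w < - a then s + w + 2 * a else s + w)"

lemma measurable_rot [measurable (raw)]: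
  assumes [measurable]: "s \<in> borel_measurable M" "w \<in> borel_measurable M"
  shows "(\<lambda>x. rot a (s x) (w x)) \<in> borel_measurable M"
  unfolding rot_def by measurable

text \<open>On each of three pieces of the interval \<open>rot\<close> is a plain translation, and
  the translated pieces tile \<open>{-a..<a}\<close> again. Since
  \<open>\<bar>s\<bar> \<le> 2 * a\<close>, a single correction by \<open>2 * a\<close> brings every
  point back.\<close>

lemma nn_integral_unif_rot:
  assumes a: "0 < a" and s: "\<bar>s\<bar> \<le> 2 * a" and [measurable]: "f \<in> borel_measurable borel"
  shows "(\<integral>\<^sup>+ w. f (rot a s w) \<partial>unif a) = (\<integral>\<^sup>+ w. f w \<partial>unif a)"
proof -
  let ?c = "ennreal (1 / (2 * a))"
  define h where "h = (\<lambda>t A w. indicator {-a..<a} w * indicator A (s + w) * f (s + w + t) :: ennreal)"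
  have shift: "(\<integral>\<^sup>+ w. h t A w \<partial>lborel)
      = (\<integral>\<^sup>+ y. indicator {-a..<a} (y - s - t) * indicator A (y - t) * f y \<partial>lborel)"
    if [measurable]: "A \<in> sets borel" for t A
    unfolding h_def
    by (subst nn_integral_real_affine[where c=1 and t="- s - t"]) (auto intro!: nn_integral_cong simp: algebra_simps)
  have [measurable]: "h t A \<in> borel_measurable borel" if [measurable]: "A \<in> sets borel" for t A
    unfolding h_def by measurable
  have "(\<integral>\<^sup>+ w. f (rot a s w) \<partial>unif a) = ?c * (\<integral>\<^sup>+ w. indicator {-a..<a} w * f (rot a s w) \<partial>lborel)"
    unfolding unif_def
    by (subst nn_integral_density, simp, simp, subst nn_integral_cmult[symmetric])
       (auto intro!: nn_integral_cong simp: indicator_def)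
  also have "(\<integral>\<^sup>+ w. indicator {-a..<a} w * f (rot a s w) \<partial>lborel)
     = (\<integral>\<^sup>+ w. h 0 {-a..<a} w + h (-2*a) {a..} w + h (2*a) {..<-a} w \<partial>lborel)"
    using a by (intro nn_integral_cong) (auto simp: h_def rot_def indicator_def)
  also have "\<dots> = (\<integral>\<^sup>+ w. h 0 {-a..<a} w \<partial>lborel) + (\<integral>\<^sup>+ w. h (-2*a) {a..} w \<partial>lborel)
      + (\<integral>\<^sup>+ w. h (2*a) {..<-a} w \<partial>lborel)"
    by (simp add: nn_integral_add)
  also have "\<dots> = (\<integral>\<^sup>+ y. indicator {-a..<a} (y - s) * indicator {-a..<a} y * f y
      + indicator {-a..<a} (y - s + 2*a) * indicator {a..} (y + 2*a) * f y
      + indicator {-a..<a} (y - s - 2*a) * indicator {..<-a} (y - 2*a) * f y \<partial>lborel)"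
    by (simp add: shift nn_integral_add)
  also have "\<dots> = (\<integral>\<^sup>+ y. indicator {-a..<a} y * f y \<partial>lborel)"
    using s a by (intro nn_integral_cong) (auto simp: indicator_def)
  also have "?c * \<dots> = (\<integral>\<^sup>+ w. f w \<partial>unif a)"
    unfolding unif_def
    by (subst nn_integral_density, simp, simp, subst nn_integral_cmult[symmetric])
       (auto intro!: nn_integral_cong simp: indicator_def)
  finally show ?thesis .
qed

text \<open>Only noise within distance \<open>\<bar>s\<bar>\<close> of one end of the interval
  leaves it under the translation, and the density is \<open>1 / (2 * a)\<close>.\<close>

lemma emeasure_unif_wrap:
  assumes a: "0 < a" 
  shows "emeasure (unif a) {w. rot a s w \<noteq> s + w} \<le> ennreal (\<bar>s\<bar> / (2 * a))"
proof -
  have meas: "{w. rot a s w \<noteq> s + w} \<in> sets borel"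
  proof -
    have "Measurable.pred borel (\<lambda>w. rot a s w \<noteq> s + w)" by measurable
    then show ?thesis by (simp add: pred_def)
  qed
  let ?J = "if 0 \<le> s then {a-s..a} else {-a..-a-s}"
  have wrap: "w \<in> ?J" if "-a \<le> w" "w < a" "rot a s w \<noteq> s + w" for w
    using that by (cases "0 \<le> s") (auto simp: rot_def split: if_splits)
  have "emeasure (unif a) {w. rot a s w \<noteq> s + w}
      = (\<integral>\<^sup>+ w. ennreal (indicator {-a..<a} w / (2 * a)) * indicator {w. rot a s w \<noteq> s + w} w \<partial>lborel)"
    unfolding unif_def using meas by (subst emeasure_density) simp_all
  also have "\<dots> \<le> (\<integral>\<^sup>+ w. ennreal (1 / (2 * a)) * indicator ?J w \<partial>lborel)"
  proof (rule nn_integral_mono)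
    fix w
    show "ennreal (indicator {-a..<a} w / (2 * a)) * indicator {w. rot a s w \<noteq> s + w} w
        \<le> ennreal (1 / (2 * a)) * indicator ?J w"
      using wrap[of w] by (cases "-a \<le> w \<and> w < a \<and> rot a s w \<noteq> s + w") (auto simp del: if_split_asm)
  qed
  also have "\<dots> = ennreal (1 / (2 * a)) * emeasure lborel (if 0 \<le> s then {a-s..a} else {-a..-a-s})"
    by (subst nn_integral_cmult_indicator) auto
  also have "\<dots> = ennreal (1 / (2 * a)) * ennreal \<bar>s\<bar>" by auto
  also have "\<dots> = ennreal (\<bar>s\<bar> / (2 * a))" using a by (simp add: ennreal_mult[symmetric])
  finally show ?thesis .
qed

subsection \<open>Two-point comparison and averaging over hypotheses\<close>

text \<open>The exponentials \<open>exp (a - k)\<close> and \<open>exp (- a - k)\<close> stand for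
  two likelihood ratios, with geometric mean \<open>exp (- k)\<close>. Their minimum is what two
  competing hypotheses share; the bound is linear in the rest, so it can be integrated using only
  that each ratio has mass 1.\<close>

lemma exp_min_plus_ge:
  fixes a k :: real
  shows "exp (- k) \<le> min (exp (a - k)) (exp (- a - k)) + (exp (a - k) + exp (- a - k)) / 4"
proof -
  have *: "1 \<le> exp (-b) + (exp b + exp (-b)) / 4" for b :: real
  proof -
    \<comment> \<open>Dividing \<open>4 * u \<le> u\<^sup>2 + 4\<close> by \<open>4 * u\<close>, for
      \<open>u = exp b\<close>, gives the inequality below.\<close>
    have "0 \<le> (exp b - 2)\<^sup>2" by simp
    then have "1 \<le> exp (-b) + exp b / 4"
      by (simp add: exp_minus power2_eq_square field_simps)
    moreover have "0 \<le> exp (-b)" by simp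
    ultimately show ?thesis unfolding add_divide_distrib by linarith
  qed
  have "1 \<le> min (exp a) (exp (-a)) + (exp a + exp (-a)) / 4"
    using *[of a] *[of "-a"] by (auto simp: min_def add.commute)
  then have "exp (-k) * 1 \<le> exp (-k) * (min (exp a) (exp (-a)) + (exp a + exp (-a)) / 4)"
    by (intro mult_left_mono) auto
  then show ?thesis
    by (simp add: exp_diff exp_minus min_def field_simps split: if_splits)
qed

text \<open>Both shifted laws are rewritten as densities against the centred one. Pointwise the two
  errors, weighted by their likelihood ratios, amount to at least the smaller ratio, whose mass is
  at least \<open>exp (- k) - 1/2\<close>. Finally \<open>1 - k \<le> exp (- k)\<close> makes the
  cost of the shift additive over the coordinates.\<close>

lemma gauss_two_point:
  assumes \<sigma>: "0 < \<sigma>" and I: "finite I"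
    and [measurable]: "F \<in> borel_measurable (PiM I (\<lambda>_. gauss \<sigma>))" "F' \<in> borel_measurable (PiM I (\<lambda>_. gauss \<sigma>))"
    and FF': "\<And>w. 1 \<le> F w + (F' w :: ennreal)"
  shows "ennreal (1/2) \<le> (\<integral>\<^sup>+ w. F (\<lambda>i\<in>I. v i + w i) \<partial>PiM I (\<lambda>_. gauss \<sigma>))
    + (\<integral>\<^sup>+ w. F' (\<lambda>i\<in>I. - v i + w i) \<partial>PiM I (\<lambda>_. gauss \<sigma>)) + ennreal (\<Sum>i\<in>I. (v i)\<^sup>2 / (2 * \<sigma>\<^sup>2))"
proof -
  interpret gauss: prob_space "gauss \<sigma>"
    using subgaussian_noise_gauss[OF \<sigma>] by (simp add: subgaussian_noise_def)
  interpret product_prob_space "\<lambda>_. gauss \<sigma>" I ..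
  interpret P: prob_space "PiM I (\<lambda>_. gauss \<sigma>)" by (rule prob_space_PiM) (rule gauss.prob_space_axioms)
  let ?P = "PiM I (\<lambda>_. gauss \<sigma>)"
  define k where "k = (\<Sum>i\<in>I. (v i)\<^sup>2 / (2 * \<sigma>\<^sup>2))"
  define R where "R s w = (\<Prod>i\<in>I. ennreal (exp (s * v i * w i / \<sigma>\<^sup>2 - (s * v i)\<^sup>2 / (2 * \<sigma>\<^sup>2))))" for s :: real and w
  have [measurable]: "R s \<in> borel_measurable ?P" for s
    unfolding R_def by measurable
  have change: "(\<integral>\<^sup>+ w. H (\<lambda>i\<in>I. s * v i + w i) \<partial>?P) = (\<integral>\<^sup>+ w. H w * R s w \<partial>?P)"
    if "H \<in> borel_measurable ?P" for H s
    unfolding R_def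
    by (rule nn_integral_PiM_componentwise[where M="\<lambda>_. gauss \<sigma>"
          and T="\<lambda>i w. s * v i + w" and \<rho>="\<lambda>i w. ennreal (exp (s * v i * w / \<sigma>\<^sup>2 - (s * v i)\<^sup>2 / (2 * \<sigma>\<^sup>2)))"])
       (auto intro!: nn_integral_gauss_shift \<sigma> I that product_sigma_finite_axioms simp: measurable_cong_sets[OF sets_gauss refl])
  have R_total: "(\<integral>\<^sup>+ w. R s w \<partial>?P) = 1" for s
    using change[of "\<lambda>_. 1" s] P.emeasure_space_1 by simp
  have R_eq: "R s w = ennreal (exp (s * (\<Sum>i\<in>I. v i * w i / \<sigma>\<^sup>2) - k))" if "s\<^sup>2 = 1" for s w
    unfolding R_def k_def using that
    by (simp add: prod_ennreal exp_sum[OF I, symmetric] sum_subtractf sum_distrib_left power_mult_distrib mult_ac)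
  have "ennreal (exp (- k)) \<le> F w * R 1 w + F' w * R (-1) w + (R 1 w + R (-1) w) * ennreal (1/4)" for w
  proof -
    define a where "a = (\<Sum>i\<in>I. v i * w i / \<sigma>\<^sup>2)"
    let ?m = "min (R 1 w) (R (-1) w)"
    have R: "R 1 w = ennreal (exp (a - k))" "R (-1) w = ennreal (exp (- a - k))"
      by (simp_all add: R_eq a_def)
    have "ennreal (exp (- k)) \<le> ennreal (min (exp (a - k)) (exp (- a - k)) + (exp (a - k) + exp (- a - k)) / 4)"
      by (intro ennreal_leI exp_min_plus_ge)
    also have "\<dots> = ennreal (min (exp (a - k)) (exp (- a - k))) + ennreal ((exp (a - k) + exp (- a - k)) / 4)"
      by (intro ennreal_plus) auto
    also have "ennreal ((exp (a - k) + exp (- a - k)) / 4) = (R 1 w + R (-1) w) * ennreal (1/4)"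
      unfolding R by (simp add: ennreal_plus[symmetric] ennreal_mult[symmetric] del: ennreal_plus)
    also have "ennreal (min (exp (a - k)) (exp (- a - k))) = 1 * ?m"
      unfolding R by (auto simp: min_def)
    also have "1 * ?m \<le> (F w + F' w) * ?m"
      by (intro mult_right_mono FF') auto
    also have "\<dots> \<le> F w * R 1 w + F' w * R (-1) w"
      unfolding distrib_right by (intro add_mono mult_left_mono) auto
    finally show ?thesis by (simp add: add_right_mono)
  qed
  then have "(\<integral>\<^sup>+ w. ennreal (exp (- k)) \<partial>?P)
      \<le> (\<integral>\<^sup>+ w. F w * R 1 w + F' w * R (-1) w + (R 1 w + R (-1) w) * ennreal (1/4) \<partial>?P)"
    by (intro nn_integral_mono)
  also have "\<dots> = (\<integral>\<^sup>+ w. F w * R 1 w \<partial>?P) + (\<integral>\<^sup>+ w. F' w * R (-1) w \<partial>?P) + (1 + 1) * ennreal (1/4)"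
    by (simp add: nn_integral_add nn_integral_multc R_total del: one_add_one)
  also have "(1 + 1) * ennreal (1/4) = ennreal (1/2)"
    by (simp add: ennreal_mult[symmetric] ennreal_numeral[symmetric] del: ennreal_numeral)
  finally have "ennreal (exp (- k)) \<le> (\<integral>\<^sup>+ w. F w * R 1 w \<partial>?P) + (\<integral>\<^sup>+ w. F' w * R (-1) w \<partial>?P) + ennreal (1/2)"
    using P.emeasure_space_1 by simp
  moreover have "ennreal (1 - k) \<le> ennreal (exp (- k))"
    using exp_ge_add_one_self[of "-k"] by (intro ennreal_leI) simp
  ultimately have "ennreal (1 - k) \<le> (\<integral>\<^sup>+ w. F w * R 1 w \<partial>?P) + (\<integral>\<^sup>+ w. F' w * R (-1) w \<partial>?P) + ennreal (1/2)"
    by (rule order_trans[rotated])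
  moreover have "0 \<le> k" unfolding k_def by (intro sum_nonneg) auto
  ultimately have "ennreal (1/2) \<le> (\<integral>\<^sup>+ w. F w * R 1 w \<partial>?P) + (\<integral>\<^sup>+ w. F' w * R (-1) w \<partial>?P) + ennreal k"
    (is "_ \<le> ?J + _")
  proof (cases ?J)
    case (real r)
    with \<open>ennreal (1 - k) \<le> ?J + ennreal (1/2)\<close> have "ennreal (1 - k) \<le> ennreal (r + 1/2)"
      by (simp only: real ennreal_plus)
    then have "1 - k \<le> r + 1/2" using real(1) by (subst (asm) ennreal_le_iff) auto
    then have "ennreal (1/2) \<le> ennreal (r + k)" by (intro ennreal_leI) simp
    then show ?thesis using real \<open>0 \<le> k\<close> by (simp only: ennreal_plus)
  next
    case top
    then show ?thesis unfolding top by simp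
  qed
  then show ?thesis
    using change[of F 1] change[of F' "-1"] by (simp add: k_def)
qed

lemma nn_integral_PiM_unif_rot:
  assumes "0 < a" "finite I" "\<And>i. \<bar>s i\<bar> \<le> 2 * a" "F \<in> borel_measurable (PiM I (\<lambda>_. unif a))"
  shows "(\<integral>\<^sup>+ w. F (\<lambda>i\<in>I. rot a (s i) (w i)) \<partial>PiM I (\<lambda>_. unif a)) = (\<integral>\<^sup>+ w. F w \<partial>PiM I (\<lambda>_. unif a))"
proof -
  interpret unif: prob_space "unif a" by (rule prob_space_unif) fact
  interpret product_prob_space "\<lambda>_. unif a" I ..
  show ?thesis
    using nn_integral_PiM_componentwise[where M="\<lambda>_. unif a" and T="\<lambda>i. rot a (s i)" and \<rho>="\<lambda>_ _. 1" and F=F and I=I]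
      assms product_sigma_finite_axioms
    by (simp add: nn_integral_unif_rot measurable_cong_sets[OF sets_unif refl] measurable_cong_sets[OF sets_unif sets_unif])
qed

section \<open>Averaging over all sign patterns\<close>

definition flip :: "'k \<Rightarrow> 'k set \<Rightarrow> 'k set" where
  "flip k S = (if k \<in> S then S - {k} else insert k S)"

lemma flip_flip [simp]: "flip k (flip k S) = S"
  by (auto simp: flip_def)

lemma mem_flip_iff: "j \<in> flip k S \<longleftrightarrow> (if j = k then j \<notin> S else j \<in> S)"
  by (simp add: flip_def)

lemma flip_subset: "k \<in> K \<Longrightarrow> S \<subseteq> K \<Longrightarrow> flip k S \<subseteq> K"
  by (auto simp: flip_def)

text \<open>The set \<open>S\<close> with the largest integral is at least as bad as the average
  over all subsets of \<open>K\<close>. For fixed \<open>x\<close>, flipping at \<open>k x\<close>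
  permutes these subsets, so summing the pair bounds counts every subset twice. Thus one
  \<open>S\<close> serves all \<open>x\<close>, although the cell that is flipped varies with
  \<open>x\<close>.\<close>

lemma exists_bad_hypothesis:
  fixes G :: "'k set \<Rightarrow> 'x \<times> 'y \<Rightarrow> ennreal"
  assumes "sigma_finite_measure Q" and K: "finite K"
    and G [measurable]: "\<And>S. S \<subseteq> K \<Longrightarrow> G S \<in> borel_measurable (P \<Otimes>\<^sub>M Q)"
    and E [measurable]: "E \<in> sets P" and k: "\<And>x. x \<in> E \<Longrightarrow> k x \<in> K"
    and pair: "\<And>x S. x \<in> E \<Longrightarrow> S \<subseteq> K \<Longrightarrow>
      \<kappa> \<le> (\<integral>\<^sup>+ y. G S (x, y) \<partial>Q) + (\<integral>\<^sup>+ y. G (flip (k x) S) (x, y) \<partial>Q)"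
  shows "\<exists>S\<subseteq>K. \<kappa> * emeasure P E \<le> 2 * (\<integral>\<^sup>+ \<omega>. G S \<omega> \<partial>(P \<Otimes>\<^sub>M Q))"
proof -
  interpret sigma_finite_measure Q by fact
  let ?I = "\<lambda>S. \<integral>\<^sup>+ \<omega>. G S \<omega> \<partial>(P \<Otimes>\<^sub>M Q)"
  let ?g = "\<lambda>S x. \<integral>\<^sup>+ y. G S (x, y) \<partial>Q"
  let ?n = "of_nat (card (Pow K)) :: ennreal"
  have "Max (?I ` Pow K) \<in> ?I ` Pow K" using K by (intro Max_in) auto
  then obtain S where S: "S \<subseteq> K" "?I S = Max (?I ` Pow K)" by auto
  have S_max: "?I T \<le> ?I S" if "T \<subseteq> K" for T
    unfolding S(2) using K that by (intro Max_ge) auto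
  have pointwise: "?n * \<kappa> * indicator E x \<le> (\<Sum>T\<in>Pow K. 2 * ?g T x)" for x
  proof (cases "x \<in> E")
    case True
    have bij: "bij_betw (flip (k x)) (Pow K) (Pow K)"
      by (rule bij_betw_byWitness[where f'="flip (k x)"]) (auto dest: flip_subset[OF k[OF True]])
    have "?n * \<kappa> = (\<Sum>T\<in>Pow K. \<kappa>)" by simp
    also have "\<dots> \<le> (\<Sum>T\<in>Pow K. ?g T x + ?g (flip (k x) T) x)"
      using True by (intro sum_mono pair) auto
    also have "\<dots> = (\<Sum>T\<in>Pow K. ?g T x) + (\<Sum>T\<in>Pow K. ?g T x)"
      by (simp add: sum.distrib sum.reindex_bij_betw[OF bij, of "\<lambda>T. ?g T x"])
    finally show ?thesis using True by (simp add: sum.distrib mult_2)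
  qed simp
  have "?n * (\<kappa> * emeasure P E) = (\<integral>\<^sup>+ x. ?n * \<kappa> * indicator E x \<partial>P)"
    by (subst nn_integral_cmult_indicator) (auto simp: mult.assoc)
  also have "\<dots> \<le> (\<integral>\<^sup>+ x. (\<Sum>T\<in>Pow K. 2 * ?g T x) \<partial>P)"
    by (intro nn_integral_mono pointwise)
  also have "\<dots> = (\<Sum>T\<in>Pow K. 2 * ?I T)"
    by (subst nn_integral_sum) (auto simp: nn_integral_cmult nn_integral_fst)
  also have "\<dots> \<le> (\<Sum>T\<in>Pow K. 2 * ?I S)"
    by (intro sum_mono mult_left_mono S_max) auto
  also have "\<dots> = ?n * (2 * ?I S)" by simp
  finally have "\<kappa> * emeasure P E \<le> 2 * ?I S"
    using K by (subst (asm) ennreal_mult_le_mult_iff) (auto simp: card_gt_0_iff[symmetric] Pow_not_empty)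
  then show ?thesis using S(1) by auto
qed

subsection \<open>Bumps on a grid\<close>

text \<open>Distance to the nearest integer: the one-dimensional tent, vanishing on cell
  boundaries.\<close>

definition dist_int :: "real \<Rightarrow> real" where
  "dist_int t = min (frac t) (1 - frac t)"

lemma dist_int_nonneg: "0 \<le> dist_int t"
  by (simp add: dist_int_def frac_lt_1 less_imp_le)

lemma dist_int_le_half: "dist_int t \<le> 1 / 2"
  by (simp add: dist_int_def min_def)

text \<open>An integer lies between \<open>s\<close> and \<open>t\<close>, and each tent is at most
  the distance to that integer.\<close>

lemma dist_int_add_le:
  assumes "\<lfloor>s\<rfloor> \<noteq> \<lfloor>t\<rfloor>"
  shows "dist_int s + dist_int t \<le> \<bar>s - t\<bar>"
proof -
  have *: "dist_int s + dist_int t \<le> t - s" if "\<lfloor>s\<rfloor> < \<lfloor>t\<rfloor>" for s t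
  proof -
    have "of_int \<lfloor>s\<rfloor> + 1 \<le> (of_int \<lfloor>t\<rfloor> :: real)" using that by linarith
    then show ?thesis by (auto simp: dist_int_def frac_def min_def)
  qed
  show ?thesis using assms *[of s t] *[of t s] by (cases "\<lfloor>s\<rfloor> < \<lfloor>t\<rfloor>") auto
qed

lemma dist_int_lipschitz: "dist_int s \<le> dist_int t + \<bar>s - t\<bar>"
proof (cases "\<lfloor>s\<rfloor> = \<lfloor>t\<rfloor>")
  case True
  then show ?thesis by (auto simp: dist_int_def frac_def min_def)
next
  case False
  then show ?thesis using dist_int_add_le[OF False] dist_int_nonneg[of t] by simp
qed

text \<open>A shift by one half carries points near an integer to points near a
  half-integer.\<close>

lemma dist_int_or_shift: "1 / 4 \<le> dist_int t \<or> 1 / 4 \<le> dist_int (t + 1 / 2)"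
proof -
  have "frac (1 / 2 :: real) = 1 / 2" by (rule frac_eq[THEN iffD2]) simp
  then have "frac (t + 1 / 2) = (if frac t < 1/2 then frac t + 1/2 else frac t - 1/2)"
    by (simp add: frac_add)
  then show ?thesis using frac_ge_0[of t] frac_lt_1[of t]
    by (auto simp: dist_int_def min_def split: if_splits)
qed

text \<open>The cells of the grid of width \<open>h\<close>, translated by \<open>h / 2\<close> in the directions in \<open>V\<close>.\<close>

definition gridpos :: "real \<Rightarrow> 'a::euclidean_space set \<Rightarrow> 'a \<Rightarrow> 'a \<Rightarrow> real" where
  "gridpos h V x b = x \<bullet> b / h + (if b \<in> V then 1 / 2 else 0)"

definition cell :: "real \<Rightarrow> 'a::euclidean_space set \<Rightarrow> 'a \<Rightarrow> 'a \<Rightarrow> int" where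
  "cell h V x = (\<lambda>b. if b \<in> Basis then \<lfloor>gridpos h V x b\<rfloor> else 0)"

text \<open>Maximum-norm distance to the boundary of the cell, in units of \<open>h\<close>: a
  pyramid over the cell.\<close>

definition bump :: "real \<Rightarrow> 'a::euclidean_space set \<Rightarrow> 'a \<Rightarrow> real" where
  "bump h V x = Min ((\<lambda>b. dist_int (gridpos h V x b)) ` Basis)"

text \<open>\<open>S\<close> lists the cells with positive sign and so encodes a vertex of the
  hypercube; \<open>A\<close> is the scale of the height.\<close>

definition hyp :: "real \<Rightarrow> real \<Rightarrow> 'a::euclidean_space set \<Rightarrow> ('a \<Rightarrow> int) set \<Rightarrow> 'a \<Rightarrow> real" where
  "hyp A h V S x = (if cell h V x \<in> S then A else - A) * bump h V x"

lemma cell_eq_iff: "cell h V x = cell h V y \<longleftrightarrow> (\<forall>b\<in>Basis. \<lfloor>gridpos h V x b\<rfloor> = \<lfloor>gridpos h V y b\<rfloor>)"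
  by (auto simp: cell_def fun_eq_iff)

lemma bump_le: "b \<in> Basis \<Longrightarrow> bump h V x \<le> dist_int (gridpos h V x b)"
  unfolding bump_def by (intro Min_le) auto

lemma bump_attained: obtains b where "b \<in> Basis" "bump h V x = dist_int (gridpos h V x b)"
proof -
  have "bump h V x \<in> (\<lambda>b. dist_int (gridpos h V x b)) ` Basis"
    unfolding bump_def by (intro Min_in) auto
  then show ?thesis using that by auto
qed

lemma bump_nonneg: "0 \<le> bump h V x"
  by (rule bump_attained[of h V x]) (simp add: dist_int_nonneg)

lemma bump_le_half: "bump h V x \<le> 1 / 2"
  by (rule bump_attained[of h V x]) (simp only: dist_int_le_half)

lemma abs_hyp: "0 \<le> A \<Longrightarrow> \<bar>hyp A h V S x\<bar> = A * bump h V x"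
  by (auto simp: hyp_def abs_mult bump_nonneg)

lemma abs_hyp_le: "0 \<le> A \<Longrightarrow> \<bar>hyp A h V S x\<bar> \<le> A / 2"
  using mult_left_mono[OF bump_le_half, of A h V x] by (simp add: abs_hyp)

lemma hyp_flip:
  "hyp A h V (flip (cell h V x) S) y = (if cell h V y = cell h V x then - hyp A h V S y else hyp A h V S y)"
  by (simp add: hyp_def mem_flip_iff)

text \<open>Within a cell the sign is constant and the pyramid has slope \<open>1 / h\<close>.
  Across cells a grid hyperplane separates the points, and the two heights together are bounded by
  their distance in that coordinate, so opposite signs do no harm.\<close>

lemma hyp_lipschitz:
  assumes "0 < h" "0 \<le> A" and c: "\<And>b. b \<in> Basis \<Longrightarrow> \<bar>(x - y) \<bullet> b\<bar> \<le> c"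
  shows "\<bar>hyp A h V S x - hyp A h V S y\<bar> \<le> A / h * c"
proof -
  have pos: "\<bar>gridpos h V x b - gridpos h V y b\<bar> \<le> c / h" if "b \<in> Basis" for b
  proof -
    have "gridpos h V x b - gridpos h V y b = (x - y) \<bullet> b / h"
      by (simp add: gridpos_def inner_diff_left diff_divide_distrib)
    then show ?thesis using c[OF that] \<open>0 < h\<close> by (simp add: divide_right_mono)
  qed
  have main: "\<bar>hyp A h V S x - hyp A h V S y\<bar> \<le> A * (c / h)"
  proof (cases "cell h V x = cell h V y")
    case True
    obtain b where b: "b \<in> Basis" "bump h V x = dist_int (gridpos h V x b)" by (rule bump_attained)
    obtain b' where b': "b' \<in> Basis" "bump h V y = dist_int (gridpos h V y b')" by (rule bump_attained)
    have "bump h V y \<le> bump h V x + c / h"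
      using bump_le[OF b(1), of h V y] dist_int_lipschitz[of "gridpos h V y b" "gridpos h V x b"] pos[OF b(1)] b(2)
      by linarith
    moreover have "bump h V x \<le> bump h V y + c / h"
      using bump_le[OF b'(1), of h V x] dist_int_lipschitz[of "gridpos h V x b'" "gridpos h V y b'"] pos[OF b'(1)] b'(2)
      by linarith
    ultimately have "\<bar>bump h V x - bump h V y\<bar> \<le> c / h" by linarith
    then have "A * \<bar>bump h V x - bump h V y\<bar> \<le> A * (c / h)"
      using \<open>0 \<le> A\<close> by (rule mult_left_mono)
    moreover have "\<bar>hyp A h V S x - hyp A h V S y\<bar> = A * \<bar>bump h V x - bump h V y\<bar>"
      using True \<open>0 \<le> A\<close> by (auto simp: hyp_def abs_mult right_diff_distrib[symmetric])
    ultimately show ?thesis by simp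
  next
    case False
    then obtain b where b: "b \<in> Basis" "\<lfloor>gridpos h V x b\<rfloor> \<noteq> \<lfloor>gridpos h V y b\<rfloor>"
      by (auto simp: cell_eq_iff)
    have "bump h V x + bump h V y \<le> c / h"
      using bump_le[OF b(1), of h V x] bump_le[OF b(1), of h V y] dist_int_add_le[OF b(2)] pos[OF b(1)]
      by linarith
    then have "A * bump h V x + A * bump h V y \<le> A * (c / h)"
      using \<open>0 \<le> A\<close> by (metis distrib_left mult_left_mono)
    then show ?thesis
      using abs_hyp[OF \<open>0 \<le> A\<close>, of h V S x] abs_hyp[OF \<open>0 \<le> A\<close>, of h V S y] by linarith
  qed
  then show ?thesis by simp
qed

lemma continuous_on_hyp:
  assumes "0 < h" "0 \<le> A"
  shows "continuous_on UNIV (hyp A h V S)"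
proof -
  have "(A / h)-lipschitz_on UNIV (hyp A h V S)"
    using assms
    by (intro lipschitz_onI) (simp_all only: dist_real_def dist_norm hyp_lipschitz Basis_le_norm divide_nonneg_pos)
  then show ?thesis by (rule lipschitz_on_continuous_on)
qed

lemma borel_measurable_hyp:
  assumes "0 < h" "0 \<le> A"
  shows "hyp A h V S \<in> borel_measurable borel"
  by (rule borel_measurable_continuous_onI) (rule continuous_on_hyp[OF assms])

lemma borel_measurable_bump:
  assumes "0 < h"
  shows "bump h V \<in> borel_measurable borel"
proof -
  have "bump h V = hyp 1 h V UNIV" by (simp add: hyp_def fun_eq_iff)
  then show ?thesis using borel_measurable_hyp[OF assms, of 1 V UNIV] by simp
qed

lemma pred_cell_eq [measurable (raw)]:
  assumes [measurable]: "f \<in> borel_measurable M" "g \<in> borel_measurable M"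
  shows "Measurable.pred M (\<lambda>\<omega>. cell h V (f \<omega>) = cell h V (g \<omega>))"
  unfolding cell_eq_iff gridpos_def by measurable

text \<open>A cell index is a bounded integer on each basis vector and 0 elsewhere, which leaves
  finitely many functions.\<close>

lemma finite_cells:
  assumes "bounded X" "0 < h"
  shows "finite (cell h V ` X)"
proof -
  obtain B where B: "\<And>x. x \<in> X \<Longrightarrow> norm x \<le> B" using assms(1) by (auto simp: bounded_iff)
  define m where "m = \<lceil>B / h\<rceil> + 2"
  have "cell h V ` X \<subseteq> {f. \<forall>b. (b \<in> Basis \<longrightarrow> f b \<in> {-m..m}) \<and> (b \<notin> Basis \<longrightarrow> f b = 0)}"
  proof -
    have "\<bar>\<lfloor>gridpos h V x b\<rfloor>\<bar> \<le> m" if "x \<in> X" "b \<in> Basis" for x b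
    proof -
      have "\<bar>x \<bullet> b\<bar> \<le> B" using B[OF that(1)] Basis_le_norm[OF that(2), of x] by linarith
      then have "\<bar>x \<bullet> b / h\<bar> \<le> B / h" using assms(2) by (simp add: divide_right_mono)
      then show ?thesis unfolding gridpos_def m_def by (auto; linarith)
    qed
    then show ?thesis by (fastforce simp: cell_def abs_le_iff)
  qed
  moreover have "finite {f :: 'a \<Rightarrow> int. \<forall>b. (b \<in> Basis \<longrightarrow> f b \<in> {-m..m}) \<and> (b \<notin> Basis \<longrightarrow> f b = 0)}"
    by (rule finite_set_of_finite_funs) auto
  ultimately show ?thesis by (rule finite_subset)
qed

lemma emeasure_cell_le:
  fixes k :: "'a::euclidean_space \<Rightarrow> int"
  assumes "0 < h"
  shows "emeasure lborel {y. cell h V y = k} \<le> ennreal (h ^ DIM('a))"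
proof -
  define l where "l = (\<Sum>b\<in>Basis. (h * (k b - (if b \<in> V then 1 / 2 else 0))) *\<^sub>R b)"
  define u where "u = (\<Sum>b\<in>Basis. (h * (k b - (if b \<in> V then 1 / 2 else 0)) + h) *\<^sub>R b)"
  have lu: "l \<bullet> b = h * (k b - (if b \<in> V then 1 / 2 else 0))" "u \<bullet> b = l \<bullet> b + h" if "b \<in> Basis" for b
    using that by (simp_all add: l_def u_def)
  have "{y. cell h V y = k} \<subseteq> cbox l u"
  proof
    fix y assume "y \<in> {y. cell h V y = k}"
    then have k: "k b = \<lfloor>gridpos h V y b\<rfloor>" if "b \<in> Basis" for b
      using that by (auto simp: cell_def)
    have "l \<bullet> b \<le> y \<bullet> b \<and> y \<bullet> b \<le> u \<bullet> b" if b: "b \<in> Basis" for b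
    proof -
      define v where "v = (if b \<in> V then 1 / 2 else 0 :: real)"
      have "k b \<le> y \<bullet> b / h + v" "y \<bullet> b / h + v \<le> k b + 1"
        using k[OF b] by (simp_all add: gridpos_def v_def)
      then have "k b - v \<le> y \<bullet> b / h" "y \<bullet> b / h \<le> k b - v + 1" by linarith+
      then have "h * (k b - v) \<le> y \<bullet> b" "y \<bullet> b \<le> h * (k b - v) + h"
        using assms by (simp_all add: field_simps)
      then show ?thesis by (simp add: lu b v_def)
    qed
    then show "y \<in> cbox l u" by (simp add: mem_box)
  qed
  then have "emeasure lborel {y. cell h V y = k} \<le> emeasure lborel (cbox l u)"
    by (intro emeasure_mono) auto
  also have "\<dots> = ennreal (h ^ DIM('a))"
    using assms by (subst emeasure_lborel_cbox) (auto simp: lu inner_diff_left)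
  finally show ?thesis .
qed

text \<open>\<open>V\<close> collects the directions in which \<open>x\<close> is closer than
  \<open>h / 4\<close> to a hyperplane of the unshifted grid; shifting by \<open>h / 2\<close> in
  exactly these moves it away.\<close>

lemma exists_grid_shift: "\<exists>V\<subseteq>Basis. 1 / 4 \<le> bump h V x"
proof -
  define V where "V = {b\<in>Basis. dist_int (x \<bullet> b / h) < 1 / 4}"
  have "1 / 4 \<le> dist_int (gridpos h V x b)" if "b \<in> Basis" for b
    using dist_int_or_shift[of "x \<bullet> b / h"] that by (auto simp: V_def gridpos_def)
  then have "1 / 4 \<le> bump h V x" by (metis bump_attained)
  then show ?thesis by (intro exI[of _ V]) (auto simp: V_def)
qed

text \<open>However \<open>X\<close> lies relative to the grid, the \<open>2 ^ DIM('a)\<close>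
  shifted grids together cover it with points of large bump, so one of them carries at least the
  average mass.\<close>

lemma exists_good_grid:
  fixes P :: "'a::euclidean_space measure"
  assumes "prob_space P" and [simp, measurable_cong]: "sets P = sets borel" and [measurable]: "X \<in> sets borel"
    and X: "emeasure P X = 1" and "0 < h"
  shows "\<exists>V. ennreal (1 / 2 ^ DIM('a)) \<le> emeasure P {x\<in>X. 1 / 4 \<le> bump h V x}"
proof -
  interpret prob_space P by fact
  note [measurable] = borel_measurable_bump[OF \<open>0 < h\<close>]
  let ?E = "\<lambda>V. {x\<in>X. 1 / 4 \<le> bump h V x}"
  have [measurable]: "?E V \<in> sets P" for V by measurable
  have "X = (\<Union>V\<in>Pow Basis. ?E V)" using exists_grid_shift[of h] by blast
  then have "1 = measure P (\<Union>V\<in>Pow Basis. ?E V)" using X by (simp add: measure_def)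
  also have "\<dots> \<le> (\<Sum>V\<in>Pow Basis. measure P (?E V))"
    by (intro finite_measure_subadditive_finite) auto
  finally have sum: "1 \<le> (\<Sum>V\<in>Pow Basis. measure P (?E V))" .
  have "\<exists>V. 1 / 2 ^ DIM('a) \<le> measure P (?E V)"
  proof (rule ccontr)
    assume "\<not> ?thesis"
    then have "(\<Sum>V\<in>Pow (Basis :: 'a set). measure P (?E V)) < (\<Sum>V\<in>Pow (Basis :: 'a set). 1 / 2 ^ DIM('a))"
      by (intro sum_strict_mono) (auto simp: not_le)
    also have "\<dots> = 1" by (simp add: card_Pow)
    finally show False using sum by simp
  qed
  then show ?thesis by (auto simp: emeasure_eq_measure intro!: ennreal_leI)
qed

text \<open>Equivalence of norms: \<open>n\<close> is Lipschitz, hence attains a positive minimum on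
  the Euclidean unit sphere, and \<open>K\<close> is the reciprocal of that minimum.\<close>

lemma is_norm_dominates_coords:
  fixes n :: "'a::euclidean_space \<Rightarrow> real"
  assumes "is_norm n"
  shows "\<exists>K>0. \<forall>z. \<forall>b\<in>Basis. \<bar>z \<bullet> b\<bar> \<le> K * n z"
proof -
  have zero: "n x = 0 \<longleftrightarrow> x = 0" and tri: "n (x + y) \<le> n x + n y" and scale: "n (c *\<^sub>R x) = \<bar>c\<bar> * n x" for x y c
    using assms by (auto simp: is_norm_def)
  have neg: "n (- x) = n x" for x using scale[of "-1" x] by simp
  have nonneg: "0 \<le> n x" for x
    using tri[of x "-x"] zero[of 0] by (simp add: neg)
  have tri_sum: "finite B \<Longrightarrow> n (\<Sum>b\<in>B. f b) \<le> (\<Sum>b\<in>B. n (f b))" for f :: "'a \<Rightarrow> 'a" and B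
    by (induction B rule: finite_induct) (use zero[of 0] in \<open>auto intro: order_trans[OF tri]\<close>)
  define C where "C = (\<Sum>b\<in>(Basis::'a set). n b)"
  have upper: "n x \<le> C * norm x" for x
  proof -
    have "n x = n (\<Sum>b\<in>Basis. (x \<bullet> b) *\<^sub>R b)" by (simp add: euclidean_representation)
    also have "\<dots> \<le> (\<Sum>b\<in>Basis. n ((x \<bullet> b) *\<^sub>R b))" by (intro tri_sum) simp
    also have "\<dots> \<le> (\<Sum>b\<in>Basis. norm x * n b)"
      by (intro sum_mono) (auto simp: scale intro!: mult_right_mono nonneg Basis_le_norm)
    finally show ?thesis by (simp add: C_def sum_distrib_left sum_distrib_right mult.commute)
  qed
  have "C-lipschitz_on UNIV n"
  proof (rule lipschitz_onI)
    fix x y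
    have "n x \<le> n y + n (x - y)" "n y \<le> n x + n (x - y)"
      using tri[of y "x - y"] tri[of x "y - x"] neg[of "x - y"] by simp_all
    then show "dist (n x) (n y) \<le> C * dist x y"
      using upper[of "x - y"] by (simp add: dist_real_def dist_norm abs_le_iff)
  qed (auto simp: C_def intro!: sum_nonneg nonneg)
  then have "continuous_on (sphere 0 1) n"
    by (rule continuous_on_subset[OF lipschitz_on_continuous_on]) simp
  moreover obtain b0 :: 'a where "b0 \<in> Basis" using nonempty_Basis by blast
  then have "sphere (0::'a) 1 \<noteq> {}" by (auto intro!: exI[of _ b0])
  ultimately obtain z where z: "z \<in> sphere 0 1" "\<And>y. y \<in> sphere 0 1 \<Longrightarrow> n z \<le> n y"
    using continuous_attains_inf[of "sphere (0::'a) 1" n] by auto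
  have pos: "0 < n z" using z(1) nonneg[of z] zero[of z] by (auto simp: order_less_le)
  have "norm x * n z \<le> n x" for x
  proof (cases "x = 0")
    case False
    have "n z \<le> n ((1 / norm x) *\<^sub>R x)" using False by (intro z(2)) simp
    then show ?thesis using False by (simp add: scale field_simps)
  qed (simp add: nonneg)
  then have "\<bar>x \<bullet> b\<bar> \<le> 1 / n z * n x" if "b \<in> Basis" for x b
    using pos order_trans[OF Basis_le_norm[OF that, of x], of "1 / n z * n x"] by (simp add: field_simps)
  then show ?thesis using pos by (intro exI[of _ "1 / n z"]) auto
qed

subsection \<open>Risk in the regression model\<close>

lemma nn_integral_PiM_component:
  assumes "prob_space M" "i \<in> I" and [measurable]: "f \<in> borel_measurable M"
  shows "(\<integral>\<^sup>+ \<omega>. f (\<omega> i) \<partial>PiM I (\<lambda>_. M)) = (\<integral>\<^sup>+ x. f x \<partial>M)"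
proof -
  have [measurable]: "(\<lambda>\<omega>. \<omega> i) \<in> PiM I (\<lambda>_. M) \<rightarrow>\<^sub>M M"
    by (rule measurable_component_singleton) fact
  have "(\<integral>\<^sup>+ x. f x \<partial>M) = (\<integral>\<^sup>+ x. f x \<partial>distr (PiM I (\<lambda>_. M)) M (\<lambda>\<omega>. \<omega> i))"
    using distr_PiM_component[of I "\<lambda>_. M" i] assms by simp
  also have "\<dots> = (\<integral>\<^sup>+ \<omega>. f (\<omega> i) \<partial>PiM I (\<lambda>_. M))"
    using assms by (intro nn_integral_distr) auto
  finally show ?thesis by simp
qed

section \<open>Zero-one error as a lower bound for both risks\<close>

definition err :: "((nat \<Rightarrow> 'a \<times> real) \<Rightarrow> 'a \<Rightarrow> real) \<Rightarrow> real \<Rightarrow> ('a \<Rightarrow> real) \<Rightarrow> (nat \<Rightarrow> 'a \<times> real) \<Rightarrow> 'a \<Rightarrow> ennreal" where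
  "err e \<delta> \<eta> D x = indicator {\<delta>..} \<bar>e D x - \<eta> x\<bar>"

lemma err_le_1: "err e \<delta> \<eta> D x \<le> 1"
  by (simp add: err_def indicator_def)

text \<open>By the triangle inequality no single estimate is closer than \<open>\<delta>\<close> to
  both values.\<close>

lemma err_two_point:
  assumes "2 * \<delta> \<le> \<bar>\<eta> x - \<eta>' x\<bar>"
  shows "1 \<le> err e \<delta> \<eta> D x + err e \<delta> \<eta>' D x"
  using assms by (auto simp: err_def indicator_def)

text \<open>A pointwise Markov inequality, for one attack below the supremum.\<close>

lemma err_le_pt_risk:
  assumes "0 \<le> \<delta>" "A \<in> attacks N q"
  shows "ennreal (\<delta>\<^sup>2) * err e \<delta> \<eta> (obs \<eta> N Xs Ws (fst A) (snd A)) x \<le> pt_risk e \<eta> N q (x, Xs, Ws)"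
proof -
  let ?r = "\<lambda>A. e (obs \<eta> N Xs Ws (fst A) (snd A)) x - \<eta> x"
  have "ennreal (\<delta>\<^sup>2) * err e \<delta> \<eta> (obs \<eta> N Xs Ws (fst A) (snd A)) x \<le> ennreal ((?r A)\<^sup>2)"
    using assms(1) by (auto simp: err_def indicator_def abs_le_square_iff[symmetric] intro!: ennreal_leI)
  also have "\<dots> \<le> pt_risk e \<eta> N q (x, Xs, Ws)"
    unfolding pt_risk_def prod.case by (rule SUP_upper) fact
  finally show ?thesis .
qed

lemma err_le_sup_risk:
  assumes "x \<in> X" "A \<in> attacks N q"
  shows "ennreal \<delta> * err e \<delta> \<eta> (obs \<eta> N Xs Ws (fst A) (snd A)) x \<le> sup_risk e \<eta> X N q (x', Xs, Ws)"
proof -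
  let ?r = "\<lambda>A x. ennreal \<bar>e (obs \<eta> N Xs Ws (fst A) (snd A)) x - \<eta> x\<bar>"
  have "ennreal \<delta> * err e \<delta> \<eta> (obs \<eta> N Xs Ws (fst A) (snd A)) x \<le> ?r A x"
    by (auto simp: err_def indicator_def intro!: ennreal_leI)
  also have "\<dots> \<le> (SUP x\<in>X. ?r A x)"
    by (rule SUP_upper) fact
  also have "\<dots> \<le> sup_risk e \<eta> X N q (x', Xs, Ws)"
    unfolding sup_risk_def prod.case by (rule SUP_upper) fact
  finally show ?thesis .
qed

lemma borel_measurable_err:
  fixes e :: "(nat \<Rightarrow> 'a::euclidean_space \<times> real) \<Rightarrow> 'a \<Rightarrow> real"
  assumes e: "is_estimator N e" and [measurable]: "\<eta> \<in> borel_measurable borel"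
    "D \<in> M \<rightarrow>\<^sub>M PiM {..<N} (\<lambda>_. borel)" "x \<in> borel_measurable M"
  shows "(\<lambda>\<omega>. err e \<delta> \<eta> (D \<omega>) (x \<omega>)) \<in> borel_measurable M"
proof -
  have "(\<lambda>\<omega>. (D \<omega>, x \<omega>)) \<in> M \<rightarrow>\<^sub>M PiM {..<N} (\<lambda>_. borel) \<Otimes>\<^sub>M borel"
    by measurable
  from measurable_compose[OF this e[unfolded is_estimator_def]]
  have [measurable]: "(\<lambda>\<omega>. e (D \<omega>) (x \<omega>)) \<in> borel_measurable M" by simp
  show ?thesis unfolding err_def by measurable
qed

lemma attacks_trivial: "({}, \<lambda>_. 0) \<in> attacks N q"
  by (simp add: attacks_def)

text \<open>\<open>K\<close> translates the norm into coordinates, to which the grid is adapted. The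
  conditions on the volume say that the uniform density on \<open>X\<close> lies between
  \<open>fm\<close> and \<open>fM\<close>.\<close>

locale regression_class =
  fixes nrm :: "'a::euclidean_space \<Rightarrow> real" and X :: "'a set" and L fm fM \<sigma> M K :: real
  assumes X: "compact X"
    and pos: "0 < L" "0 < fm" "0 < \<sigma>" "0 < M" "0 < K"
    and coords: "\<And>z b. b \<in> Basis \<Longrightarrow> \<bar>z \<bullet> b\<bar> \<le> K * nrm z"
    and volume: "fm * measure lborel X \<le> 1" "1 \<le> fM * measure lborel X"
begin

section \<open>The uniform input law on the domain\<close>

definition vol :: real where "vol = measure lborel X"

lemma vol_pos: "0 < vol"
  using volume(2) measure_nonneg[of lborel X] unfolding vol_def by (cases "measure lborel X = 0") (auto simp only: order_less_le mult_zero_right not_one_le_zero)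

lemma X_borel [measurable]: "X \<in> sets borel"
  using X by (simp add: compact_imp_closed borel_closed)

lemma emeasure_X: "emeasure lborel X = ennreal vol"
  unfolding vol_def using X emeasure_compact_finite[of X] by (intro emeasure_eq_ennreal_measure) auto

definition f0 :: "'a \<Rightarrow> real" where "f0 x = indicator X x / vol"

lemma borel_measurable_f0 [measurable]: "f0 \<in> borel_measurable borel"
  unfolding f0_def by measurable

definition P :: "'a measure" where "P = density lborel (\<lambda>x. ennreal (f0 x))"

lemma sets_P [measurable_cong, simp]: "sets P = sets borel"
  by (simp add: P_def)

lemma space_P [simp]: "space P = UNIV"
  by (simp add: P_def)

lemma emeasure_P:
  assumes [measurable]: "A \<in> sets borel"
  shows "emeasure P A = ennreal (1 / vol) * emeasure lborel (A \<inter> X)"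
proof -
  have "emeasure P A = (\<integral>\<^sup>+ x. ennreal (1 / vol) * indicator (A \<inter> X) x \<partial>lborel)"
    unfolding P_def by (subst emeasure_density) (auto intro!: nn_integral_cong simp: f0_def indicator_def)
  also have "\<dots> = ennreal (1 / vol) * emeasure lborel (A \<inter> X)"
    by (subst nn_integral_cmult_indicator) auto
  finally show ?thesis .
qed

lemma emeasure_P_X: "emeasure P X = 1" "emeasure P UNIV = 1"
  using vol_pos by (simp_all add: emeasure_P emeasure_X ennreal_mult[symmetric])

lemma prob_space_P: "prob_space P"
  by (rule prob_spaceI) (simp add: emeasure_P_X)

sublocale P: prob_space P by (rule prob_space_P)

lemma emeasure_P_cell:
  assumes "0 < h"
  shows "emeasure P {y. cell h V y = k} \<le> ennreal (h ^ DIM('a) / vol)"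
\<comment> \<open>An index that occurs is \<open>cell h V x\<close> for some \<open>x\<close>, which
  gives measurability of the cell; any other index has the empty set as its cell.\<close>
proof (cases "\<exists>x. cell h V x = k")
  case True
  then obtain x where k: "k = cell h V x" by auto
  have [measurable]: "{y. cell h V y = k} \<in> sets borel"
    using pred_cell_eq[of "\<lambda>y. y" borel "\<lambda>y. x" h V] by (simp add: k pred_def)
  have "emeasure P {y. cell h V y = k} \<le> ennreal (1 / vol) * ennreal (h ^ DIM('a))"
    unfolding emeasure_P[OF \<open>_ \<in> sets borel\<close>]
    by (intro mult_left_mono order_trans[OF emeasure_mono emeasure_cell_le[OF assms, of V k]]) auto
  also have "\<dots> = ennreal (h ^ DIM('a) / vol)"
    using assms vol_pos by (simp add: ennreal_mult[symmetric])
  finally show ?thesis .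
qed simp

text \<open>With height scale \<open>L * h / K\<close> the slope is \<open>L / K\<close> per
  coordinate difference, and \<open>K\<close> turns this into Lipschitz constant \<open>L\<close>
  for \<open>nrm\<close>. The values stay below half the height scale, hence below
  \<open>M\<close>.\<close>

lemma in_class_hyp:
  assumes "0 < h" "L * h / K \<le> 2 * M" "subgaussian_noise \<sigma> \<gamma>"
  shows "in_class nrm X L fm fM M \<sigma> N f0 (hyp (L * h / K) h V S) (\<lambda>_. \<gamma>)"
proof -
  let ?A = "L * h / K"
  have A: "0 \<le> ?A" using assms(1) pos by simp
  have "\<bar>hyp ?A h V S x - hyp ?A h V S y\<bar> \<le> L * nrm (x - y)" for x y
    using hyp_lipschitz[OF assms(1) A, of x y "K * nrm (x - y)" V S] coords assms(1) pos by simp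
  moreover have "\<bar>hyp ?A h V S x\<bar> \<le> M" for x
    by (rule order_trans[OF abs_hyp_le[OF A]]) (use assms(2) in simp)
  moreover have "(\<integral>\<^sup>+ x. ennreal (f0 x) \<partial>lborel) = 1"
    using emeasure_P_X(2) unfolding P_def by (simp add: emeasure_density)
  moreover have "fm \<le> f0 x \<and> f0 x \<le> fM" if "x \<in> X" for x
    using that volume vol_pos by (simp add: f0_def vol_def field_simps)
  moreover have "0 \<le> f0 x" "x \<notin> X \<Longrightarrow> f0 x = 0" for x
    using vol_pos by (simp_all add: f0_def)
  moreover have "f0 \<in> borel_measurable lborel" by simp
  ultimately show ?thesis
    using assms(3) unfolding in_class_def subgaussian_noise_def by blast
qed

text \<open>Each input in the cell of \<open>x\<close> costs \<open>c\<close>; one input lands there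
  with probability at most \<open>h ^ DIM('a) / vol\<close>, and expectation is linear.\<close>

lemma expected_cell_hits:
  fixes N :: nat
  assumes "0 < h" "0 \<le> c"
  shows "(\<integral>\<^sup>+ Xs. (\<Sum>i<N. ennreal (if cell h V (Xs i) = cell h V x then c else 0)) \<partial>PiM {..<N} (\<lambda>_. P))
    \<le> ennreal (c * N * h ^ DIM('a) / vol)"
proof -
  let ?g = "\<lambda>y. ennreal (if cell h V y = cell h V x then c else 0)"
  have [measurable]: "?g \<in> borel_measurable borel" by measurable
  have "(\<integral>\<^sup>+ y. ?g y \<partial>P) = (\<integral>\<^sup>+ y. ennreal c * indicator {y. cell h V y = cell h V x} y \<partial>P)"
    by (intro nn_integral_cong) (auto simp: indicator_def)
  also have "\<dots> = ennreal c * emeasure P {y. cell h V y = cell h V x}"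
    using pred_cell_eq[of "\<lambda>y. y" borel "\<lambda>y. x" h V]
    by (subst nn_integral_cmult_indicator) (auto simp: pred_def)
  also have "\<dots> \<le> ennreal c * ennreal (h ^ DIM('a) / vol)"
    by (intro mult_left_mono emeasure_P_cell assms) auto
  also have "\<dots> = ennreal (c * h ^ DIM('a) / vol)"
    using assms vol_pos by (simp add: ennreal_mult[symmetric])
  finally have one: "(\<integral>\<^sup>+ y. ?g y \<partial>P) \<le> ennreal (c * h ^ DIM('a) / vol)" .
  have "(\<integral>\<^sup>+ Xs. (\<Sum>i<N. ?g (Xs i)) \<partial>PiM {..<N} (\<lambda>_. P)) = (\<Sum>i<N. \<integral>\<^sup>+ Xs. ?g (Xs i) \<partial>PiM {..<N} (\<lambda>_. P))"
    by (rule nn_integral_sum) measurable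
  also have "\<dots> = (\<Sum>i<N. \<integral>\<^sup>+ y. ?g y \<partial>P)"
    by (intro sum.cong refl nn_integral_PiM_component prob_space_P) auto
  also have "\<dots> \<le> (\<Sum>i<N. ennreal (c * h ^ DIM('a) / vol))"
    by (intro sum_mono one)
  also have "\<dots> = ennreal (c * N * h ^ DIM('a) / vol)"
    using assms vol_pos by (simp add: ennreal_of_nat_eq_real_of_nat ennreal_mult[symmetric] mult_ac)
  finally show ?thesis .
qed

section \<open>From two-point bounds to the worst-case risk\<close>

definition Q :: "real measure \<Rightarrow> nat \<Rightarrow> ((nat \<Rightarrow> 'a) \<times> (nat \<Rightarrow> real)) measure" where
  "Q \<gamma> N = PiM {..<N} (\<lambda>_. P) \<Otimes>\<^sub>M PiM {..<N} (\<lambda>_. \<gamma>)"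

lemma sample_space_eq: "sample_space f0 (\<lambda>_. \<gamma>) N = P \<Otimes>\<^sub>M Q \<gamma> N"
  by (simp add: sample_space_def P_def Q_def)

text \<open>Averaging over the signs on the cells that meet \<open>X\<close>, for test points where
  the bump is large; these have mass at least \<open>1 / 2 ^ DIM('a)\<close>. The risk
  \<open>R\<close>, a supremum over attacks, enters only through the measurable minorant
  \<open>c * G\<close>.\<close>

lemma exists_bad_regression:
  assumes "0 < h" and \<gamma>: "prob_space \<gamma>"
    and V: "ennreal (1 / 2 ^ DIM('a)) \<le> emeasure P {x\<in>X. 1 / 4 \<le> bump h V x}"
    and G: "\<And>S. G S \<in> borel_measurable (sample_space f0 (\<lambda>_. \<gamma>) N)"
    and pair: "\<And>x S. x \<in> X \<Longrightarrow> 1 / 4 \<le> bump h V x \<Longrightarrow>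
      ennreal \<kappa> \<le> (\<integral>\<^sup>+ y. G S (x, y) \<partial>Q \<gamma> N) + (\<integral>\<^sup>+ y. G (flip (cell h V x) S) (x, y) \<partial>Q \<gamma> N)"
    and c: "0 \<le> c" "0 \<le> \<kappa>" and R: "\<And>S \<omega>. ennreal c * G S \<omega> \<le> R S \<omega>"
  shows "\<exists>S. ennreal (c * \<kappa> / (2 * 2 ^ DIM('a))) \<le> (\<integral>\<^sup>+ \<omega>. R S \<omega> \<partial>sample_space f0 (\<lambda>_. \<gamma>) N)"
proof -
  interpret \<gamma>: prob_space \<gamma> by fact
  interpret PX: prob_space "PiM {..<N} (\<lambda>_. P)" by (intro prob_space_PiM prob_space_P)
  interpret PW: prob_space "PiM {..<N} (\<lambda>_. \<gamma>)" by (intro prob_space_PiM \<gamma>)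
  interpret XW: pair_prob_space "PiM {..<N} (\<lambda>_. P)" "PiM {..<N} (\<lambda>_. \<gamma>)" ..
  note [measurable] = borel_measurable_bump[OF \<open>0 < h\<close>]
  let ?E = "{x\<in>X. 1 / 4 \<le> bump h V x}"
  let ?I = "\<lambda>S. \<integral>\<^sup>+ \<omega>. G S \<omega> \<partial>sample_space f0 (\<lambda>_. \<gamma>) N"
  have "\<exists>S\<subseteq>cell h V ` X. ennreal \<kappa> * emeasure P ?E \<le> 2 * (\<integral>\<^sup>+ \<omega>. G S \<omega> \<partial>(P \<Otimes>\<^sub>M Q \<gamma> N))"
  proof (rule exists_bad_hypothesis[where k="cell h V"])
    show "sigma_finite_measure (Q \<gamma> N)" unfolding Q_def ..
    show "finite (cell h V ` X)" using X \<open>0 < h\<close> by (intro finite_cells compact_imp_bounded)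
    show "?E \<in> sets P" by measurable
  qed (use G pair in \<open>auto simp: sample_space_eq\<close>)
  then obtain S where S: "ennreal \<kappa> * emeasure P ?E \<le> 2 * ?I S" by (auto simp: sample_space_eq)
  have "ennreal (c * \<kappa> / (2 * 2 ^ DIM('a))) = ennreal (c / 2) * (ennreal \<kappa> * ennreal (1 / 2 ^ DIM('a)))"
    using c by (simp add: ennreal_mult[symmetric])
  also have "\<dots> \<le> ennreal (c / 2) * (ennreal \<kappa> * emeasure P ?E)"
    by (intro mult_left_mono V) auto
  also have "\<dots> \<le> ennreal (c / 2) * (2 * ?I S)"
    by (intro mult_left_mono S) auto
  also have "\<dots> = ennreal (c / 2) * ennreal 2 * ?I S"
    by (simp add: mult.assoc)
  also have "\<dots> = ennreal c * ?I S"
    using c by (subst ennreal_mult[symmetric]) auto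
  also have "\<dots> = (\<integral>\<^sup>+ \<omega>. ennreal c * G S \<omega> \<partial>sample_space f0 (\<lambda>_. \<gamma>) N)"
    by (rule nn_integral_cmult[symmetric]) (rule G)
  also have "\<dots> \<le> (\<integral>\<^sup>+ \<omega>. R S \<omega> \<partial>sample_space f0 (\<lambda>_. \<gamma>) N)"
    by (intro nn_integral_mono R)
  finally show ?thesis ..
qed

definition worst_pt_risk where
  "worst_pt_risk e N q = (SUP t\<in>{(f, \<eta>, \<mu>). in_class nrm X L fm fM M \<sigma> N f \<eta> \<mu>}.
     \<integral>\<^sup>+ \<omega>. pt_risk e (fst (snd t)) N q \<omega> \<partial>sample_space (fst t) (snd (snd t)) N)"

definition worst_sup_risk where
  "worst_sup_risk e N q = (SUP t\<in>{(f, \<eta>, \<mu>). in_class nrm X L fm fM M \<sigma> N f \<eta> \<mu>}.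
     \<integral>\<^sup>+ \<omega>. sup_risk e (fst (snd t)) X N q \<omega> \<partial>sample_space (fst t) (snd (snd t)) N)"

text \<open>\<open>G\<close> is bounded by the sum of two errors under admissible attacks, so half
  of it is below the risk. The factor 16 collects this 2, the 4 from the pair bound and the 2 from
  averaging over signs; \<open>2 ^ DIM('a)\<close> is the loss from the choice of the grid.\<close>

lemma worst_risk_ge:
  fixes h A \<delta> :: real
  defines "A \<equiv> L * h / K" and "\<delta> \<equiv> L * h / K / 4"
  assumes h: "0 < h" "L * h / K \<le> 2 * M" and \<gamma>: "subgaussian_noise \<sigma> \<gamma>"
    and V: "ennreal (1 / 2 ^ DIM('a)) \<le> emeasure P {x\<in>X. 1 / 4 \<le> bump h V x}"
    and G: "\<And>S. G S \<in> borel_measurable (sample_space f0 (\<lambda>_. \<gamma>) N)"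
    and G_outside: "\<And>S x y. x \<notin> X \<Longrightarrow> G S (x, y) = 0"
    and G_attack: "\<And>S x Xs Ws. x \<in> X \<Longrightarrow> \<exists>a\<in>attacks N q. \<exists>b\<in>attacks N q. G S (x, Xs, Ws)
      \<le> err e \<delta> (hyp A h V S) (obs (hyp A h V S) N Xs Ws (fst a) (snd a)) x
       + err e \<delta> (hyp A h V S) (obs (hyp A h V S) N Xs Ws (fst b) (snd b)) x"
    and pair: "\<And>x S. x \<in> X \<Longrightarrow> 1 / 4 \<le> bump h V x \<Longrightarrow>
      ennreal (1/4) \<le> (\<integral>\<^sup>+ y. G S (x, y) \<partial>Q \<gamma> N) + (\<integral>\<^sup>+ y. G (flip (cell h V x) S) (x, y) \<partial>Q \<gamma> N)"
  shows "ennreal (\<delta>\<^sup>2 / (16 * 2 ^ DIM('a))) \<le> worst_pt_risk e N q"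
    and "ennreal (\<delta> / (16 * 2 ^ DIM('a))) \<le> worst_sup_risk e N q"
proof -
  have \<delta>: "0 \<le> \<delta>" unfolding \<delta>_def using h pos by simp
  have \<gamma>': "prob_space \<gamma>" using \<gamma> by (simp add: subgaussian_noise_def)
  let ?\<eta> = "hyp A h V"
  have half: "ennreal (c / 2) * g \<le> r"
    if "g \<le> u + v" "ennreal c * u \<le> r" "ennreal c * v \<le> r" "0 \<le> c" for c and g u v r :: ennreal
  proof -
    have cc: "ennreal (c / 2) = ennreal (1/2) * ennreal c"
      using that(4) by (subst ennreal_mult[symmetric]) auto
    have "ennreal (c / 2) * g \<le> ennreal (c / 2) * (u + v)" by (intro mult_left_mono that) auto
    also have "\<dots> = ennreal (1/2) * (ennreal c * u) + ennreal (1/2) * (ennreal c * v)"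
      by (simp only: cc distrib_left mult.assoc)
    also have "\<dots> \<le> ennreal (1/2) * r + ennreal (1/2) * r"
      by (intro add_mono mult_left_mono that) auto
    also have "\<dots> = (ennreal (1/2) + ennreal (1/2)) * r" by (simp only: distrib_right)
    also have "ennreal (1/2) + ennreal (1/2) = 1"
      by (subst ennreal_plus[symmetric]) auto
    finally show ?thesis by simp
  qed
  have pt: "ennreal (\<delta>\<^sup>2 / 2) * G S \<omega> \<le> pt_risk e (?\<eta> S) N q \<omega>" for S \<omega>
  proof (cases \<omega>)
    case (fields x Xs Ws)
    show ?thesis
    proof (cases "x \<in> X")
      case True
      obtain a b where ab: "a \<in> attacks N q" "b \<in> attacks N q" and
        le: "G S (x, Xs, Ws) \<le> err e \<delta> (?\<eta> S) (obs (?\<eta> S) N Xs Ws (fst a) (snd a)) x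
          + err e \<delta> (?\<eta> S) (obs (?\<eta> S) N Xs Ws (fst b) (snd b)) x"
        using G_attack[OF True] by blast
      show ?thesis
        unfolding fields
        by (rule half[OF le err_le_pt_risk[OF \<delta> ab(1)] err_le_pt_risk[OF \<delta> ab(2)]]) simp
    qed (simp add: G_outside fields)
  qed
  have sp: "ennreal (\<delta> / 2) * G S \<omega> \<le> sup_risk e (?\<eta> S) X N q \<omega>" for S \<omega>
  proof (cases \<omega>)
    case (fields x Xs Ws)
    show ?thesis
    proof (cases "x \<in> X")
      case True
      obtain a b where ab: "a \<in> attacks N q" "b \<in> attacks N q" and
        le: "G S (x, Xs, Ws) \<le> err e \<delta> (?\<eta> S) (obs (?\<eta> S) N Xs Ws (fst a) (snd a)) x
          + err e \<delta> (?\<eta> S) (obs (?\<eta> S) N Xs Ws (fst b) (snd b)) x"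
        using G_attack[OF True] by blast
      show ?thesis
        unfolding fields
        by (rule half[OF le err_le_sup_risk[OF True ab(1)] err_le_sup_risk[OF True ab(2)] \<delta>])
    qed (simp add: G_outside fields)
  qed
  have cl: "(f0, ?\<eta> S, \<lambda>_. \<gamma>) \<in> {(f, \<eta>, \<mu>). in_class nrm X L fm fM M \<sigma> N f \<eta> \<mu>}" for S
    using in_class_hyp[OF h \<gamma>] by (simp add: A_def)
  obtain S where "ennreal (\<delta>\<^sup>2 / 2 * (1/4) / (2 * 2 ^ DIM('a)))
      \<le> (\<integral>\<^sup>+ \<omega>. pt_risk e (?\<eta> S) N q \<omega> \<partial>sample_space f0 (\<lambda>_. \<gamma>) N)"
    using exists_bad_regression[OF h(1) \<gamma>' V G pair _ _ pt] by auto
  also have "\<dots> \<le> worst_pt_risk e N q"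
    unfolding worst_pt_risk_def by (rule SUP_upper2[OF cl[of S]]) simp
  finally show "ennreal (\<delta>\<^sup>2 / (16 * 2 ^ DIM('a))) \<le> worst_pt_risk e N q" by simp
  obtain S' where "ennreal (\<delta> / 2 * (1/4) / (2 * 2 ^ DIM('a)))
      \<le> (\<integral>\<^sup>+ \<omega>. sup_risk e (?\<eta> S') X N q \<omega> \<partial>sample_space f0 (\<lambda>_. \<gamma>) N)"
    using exists_bad_regression[OF h(1) \<gamma>' V G pair _ _ sp] \<delta> by auto
  also have "\<dots> \<le> worst_sup_risk e N q"
    unfolding worst_sup_risk_def by (rule SUP_upper2[OF cl[of S']]) simp
  finally show "ennreal (\<delta> / (16 * 2 ^ DIM('a))) \<le> worst_sup_risk e N q" by simp
qed

lemma nn_integral_Q: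
  assumes "prob_space \<gamma>" and g: "g \<in> borel_measurable (sample_space f0 (\<lambda>_. \<gamma>) N)"
  shows "(\<integral>\<^sup>+ y. g (x, y) \<partial>Q \<gamma> N)
    = (\<integral>\<^sup>+ Xs. (\<integral>\<^sup>+ Ws. g (x, Xs, Ws) \<partial>PiM {..<N} (\<lambda>_. \<gamma>)) \<partial>PiM {..<N} (\<lambda>_. P))"
    and "(\<lambda>Xs. \<integral>\<^sup>+ Ws. g (x, Xs, Ws) \<partial>PiM {..<N} (\<lambda>_. \<gamma>)) \<in> borel_measurable (PiM {..<N} (\<lambda>_. P))"
proof -
  interpret PW: prob_space "PiM {..<N} (\<lambda>_. \<gamma>)" by (intro prob_space_PiM assms)
  have "(\<lambda>y. g (x, y)) \<in> borel_measurable (Q \<gamma> N)"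
    using g unfolding sample_space_eq by (rule measurable_compose_Pair1[rotated]) simp
  then have meas: "(\<lambda>y. g (x, y)) \<in> borel_measurable (PiM {..<N} (\<lambda>_. P) \<Otimes>\<^sub>M PiM {..<N} (\<lambda>_. \<gamma>))"
    by (simp add: Q_def)
  show "(\<integral>\<^sup>+ y. g (x, y) \<partial>Q \<gamma> N)
    = (\<integral>\<^sup>+ Xs. (\<integral>\<^sup>+ Ws. g (x, Xs, Ws) \<partial>PiM {..<N} (\<lambda>_. \<gamma>)) \<partial>PiM {..<N} (\<lambda>_. P))"
    unfolding Q_def using PW.nn_integral_fst[OF meas] by simp
  show "(\<lambda>Xs. \<integral>\<^sup>+ Ws. g (x, Xs, Ws) \<partial>PiM {..<N} (\<lambda>_. \<gamma>)) \<in> borel_measurable (PiM {..<N} (\<lambda>_. P))"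
    using PW.borel_measurable_nn_integral_fst[OF meas] by simp
qed

text \<open>The two-point bound is proved conditionally on the inputs, with a loss for each input in
  the cell of \<open>x\<close>. Integrating over the inputs leaves \<open>s\<close> out of
  \<open>t\<close> once the expected loss is at most \<open>t - s\<close>.\<close>

lemma pair_bound:
  assumes \<gamma>: "prob_space \<gamma>" and "0 < h" "0 \<le> c"
    and g: "g \<in> borel_measurable (sample_space f0 (\<lambda>_. \<gamma>) N)"
    and g': "g' \<in> borel_measurable (sample_space f0 (\<lambda>_. \<gamma>) N)"
    and le: "\<And>Xs. ennreal t \<le> (\<integral>\<^sup>+ Ws. g (x, Xs, Ws) \<partial>PiM {..<N} (\<lambda>_. \<gamma>))
      + (\<integral>\<^sup>+ Ws. g' (x, Xs, Ws) \<partial>PiM {..<N} (\<lambda>_. \<gamma>))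
      + (\<Sum>i<N. ennreal (if cell h V (Xs i) = cell h V x then c else 0))"
    and small: "c * real N * h ^ DIM('a) / vol \<le> t - s" and "0 \<le> s"
  shows "ennreal s \<le> (\<integral>\<^sup>+ y. g (x, y) \<partial>Q \<gamma> N) + (\<integral>\<^sup>+ y. g' (x, y) \<partial>Q \<gamma> N)"
proof -
  interpret PX: prob_space "PiM {..<N} (\<lambda>_. P)" by (intro prob_space_PiM prob_space_P)
  let ?I = "\<lambda>g. \<integral>\<^sup>+ y. g (x, y) \<partial>Q \<gamma> N"
  let ?b = "\<lambda>Xs. \<Sum>i<N. ennreal (if cell h V (Xs i) = cell h V x then c else 0)"
  note [measurable] = nn_integral_Q(2)[OF \<gamma> g, of x] nn_integral_Q(2)[OF \<gamma> g', of x]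
  have [measurable]: "?b \<in> borel_measurable (PiM {..<N} (\<lambda>_. P))" by measurable
  have "ennreal t = (\<integral>\<^sup>+ Xs. ennreal t \<partial>PiM {..<N} (\<lambda>_. P))"
    using PX.emeasure_space_1 by simp
  also have "\<dots> \<le> (\<integral>\<^sup>+ Xs. (\<integral>\<^sup>+ Ws. g (x, Xs, Ws) \<partial>PiM {..<N} (\<lambda>_. \<gamma>))
      + (\<integral>\<^sup>+ Ws. g' (x, Xs, Ws) \<partial>PiM {..<N} (\<lambda>_. \<gamma>)) + ?b Xs \<partial>PiM {..<N} (\<lambda>_. P))"
    by (intro nn_integral_mono le)
  also have "\<dots> = ?I g + ?I g' + (\<integral>\<^sup>+ Xs. ?b Xs \<partial>PiM {..<N} (\<lambda>_. P))"
    by (simp only: nn_integral_Q(1)[OF \<gamma> g] nn_integral_Q(1)[OF \<gamma> g'] nn_integral_add borel_measurable_add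
        \<open>?b \<in> _\<close> nn_integral_Q(2)[OF \<gamma> g] nn_integral_Q(2)[OF \<gamma> g'])
  also have "\<dots> \<le> ?I g + ?I g' + ennreal (t - s)"
    by (intro add_mono order_refl order_trans[OF expected_cell_hits] ennreal_leI small assms)
  finally have le': "ennreal t \<le> ?I g + ?I g' + ennreal (t - s)" .
  have "0 \<le> c * real N * h ^ DIM('a) / vol"
    using assms(2,3) vol_pos by simp
  with small have ts: "0 \<le> t - s" by linarith
  show ?thesis
  proof (cases "?I g + ?I g'")
    case (real r)
    with le' ts have "ennreal t \<le> ennreal (r + (t - s))" by simp
    then have "t \<le> r + (t - s)" using real(1) ts by (subst (asm) ennreal_le_iff) auto
    then show ?thesis unfolding real by (intro ennreal_leI) simp
  qed (simp only: top_greatest)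
qed

text \<open>Gaussian noise and no corruption. An input in the flipped cell costs at most
  \<open>A\<^sup>2 / (8 * \<sigma>\<^sup>2)\<close>, since the two regression functions deviate from
  their midpoint by at most \<open>A / 2\<close> there.\<close>

lemma clean_data_bound:
  fixes N :: nat
  assumes e: "is_estimator N e" and h: "0 < h" "L * h / K \<le> 2 * M"
    and small: "(L * h / K)\<^sup>2 / (8 * \<sigma>\<^sup>2) * real N * h ^ DIM('a) / vol \<le> 1 / 4"
  shows "ennreal ((L * h / K / 4)\<^sup>2 / (16 * 2 ^ DIM('a))) \<le> worst_pt_risk e N q"
    and "ennreal (L * h / K / 4 / (16 * 2 ^ DIM('a))) \<le> worst_sup_risk e N q"
proof -
  define A where "A = L * h / K"
  define \<delta> where "\<delta> = L * h / K / 4"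
  have A: "0 \<le> A" using h pos by (simp add: A_def)
  have noise: "subgaussian_noise \<sigma> (gauss \<sigma>)" by (rule subgaussian_noise_gauss) (rule pos)
  then have \<gamma>: "prob_space (gauss \<sigma>)" by (simp add: subgaussian_noise_def)
  obtain V where V: "ennreal (1 / 2 ^ DIM('a)) \<le> emeasure P {x\<in>X. 1 / 4 \<le> bump h V x}"
    using exists_good_grid[OF prob_space_P sets_P X_borel emeasure_P_X(1) h(1)] by blast
  note [measurable] = borel_measurable_hyp[OF h(1) A]
  define \<eta> where "\<eta> = hyp A h V"
  have [measurable]: "\<eta> S \<in> borel_measurable borel" for S unfolding \<eta>_def by measurable
  define dat where "dat S Xs Ws = (\<lambda>i\<in>{..<N}. (Xs i, \<eta> S (Xs i) + Ws i))" for S Xs and Ws :: "nat \<Rightarrow> real"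
  define G where "G S = (\<lambda>(x, Xs, Ws). indicator X x * err e \<delta> (\<eta> S) (dat S Xs Ws) x)" for S
  have G_meas: "G S \<in> borel_measurable (sample_space f0 (\<lambda>_. gauss \<sigma>) N)" for S
  proof -
    have "(\<lambda>\<omega>. err e \<delta> (\<eta> S) (dat S (fst (snd \<omega>)) (snd (snd \<omega>))) (fst \<omega>))
        \<in> borel_measurable (P \<Otimes>\<^sub>M PiM {..<N} (\<lambda>_. P) \<Otimes>\<^sub>M PiM {..<N} (\<lambda>_. gauss \<sigma>))"
      unfolding dat_def by (rule borel_measurable_err[OF e]) measurable
    then show ?thesis
      unfolding G_def sample_space_eq Q_def split_beta' by measurable
  qed
  have pair: "ennreal (1/4) \<le> (\<integral>\<^sup>+ y. G S (x, y) \<partial>Q (gauss \<sigma>) N)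
      + (\<integral>\<^sup>+ y. G (flip (cell h V x) S) (x, y) \<partial>Q (gauss \<sigma>) N)"
    if x: "x \<in> X" "1 / 4 \<le> bump h V x" for x S
  proof (rule pair_bound[where t="1/2" and c="A\<^sup>2 / (8 * \<sigma>\<^sup>2)", OF \<gamma> h(1) _ G_meas G_meas])
    let ?T = "flip (cell h V x) S"
    have T: "\<eta> ?T y = (if cell h V y = cell h V x then - \<eta> S y else \<eta> S y)" for y
      unfolding \<eta>_def by (rule hyp_flip)
    \<comment> \<open>The flip negates the value at \<open>x\<close>, so the gap is
      \<open>2 * A * bump h V x\<close>, at least \<open>A / 2\<close>.\<close>
    have sep: "2 * \<delta> \<le> \<bar>\<eta> S x - \<eta> ?T x\<bar>"
    proof -
      have "A * (1 / 4) \<le> A * bump h V x" using A x(2) by (rule mult_left_mono[rotated])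
      then show ?thesis using abs_hyp[OF A, of h V S x] unfolding T by (simp add: \<eta>_def \<delta>_def A_def)
    qed
    show "ennreal (1/2) \<le> (\<integral>\<^sup>+ Ws. G S (x, Xs, Ws) \<partial>PiM {..<N} (\<lambda>_. gauss \<sigma>))
      + (\<integral>\<^sup>+ Ws. G ?T (x, Xs, Ws) \<partial>PiM {..<N} (\<lambda>_. gauss \<sigma>))
      + (\<Sum>i<N. ennreal (if cell h V (Xs i) = cell h V x then A\<^sup>2 / (8 * \<sigma>\<^sup>2) else 0))" for Xs
    proof -
      \<comment> \<open>Recentring the labels at the midpoint of the two hypotheses gives them the
        opposite means \<open>v\<close> and \<open>- v\<close>; \<open>v\<close> vanishes outside
        the cell of \<open>x\<close>.\<close>
      define m where "m i = (\<eta> S (Xs i) + \<eta> ?T (Xs i)) / 2" for i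
      define v where "v i = (\<eta> S (Xs i) - \<eta> ?T (Xs i)) / 2" for i
      have mv: "m i + (v i + w) = \<eta> S (Xs i) + w" "m i + (w - v i) = \<eta> ?T (Xs i) + w" for i w
        by (simp_all add: m_def v_def add_divide_distrib diff_divide_distrib)
      define F where "F R w = err e \<delta> (\<eta> R) (\<lambda>i\<in>{..<N}. (Xs i, m i + w i)) x" for R w
      have F_meas: "F R \<in> borel_measurable (PiM {..<N} (\<lambda>_. gauss \<sigma>))" for R
        unfolding F_def by (rule borel_measurable_err[OF e]) measurable
      have FF: "1 \<le> F S w + F ?T w" for w
        unfolding F_def by (rule err_two_point[where \<eta>="\<eta> S" and \<eta>'="\<eta> ?T" and x=x, OF sep])
      have "ennreal (1/2) \<le> (\<integral>\<^sup>+ w. F S (\<lambda>i\<in>{..<N}. v i + w i) \<partial>PiM {..<N} (\<lambda>_. gauss \<sigma>))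
        + (\<integral>\<^sup>+ w. F ?T (\<lambda>i\<in>{..<N}. - v i + w i) \<partial>PiM {..<N} (\<lambda>_. gauss \<sigma>))
        + ennreal (\<Sum>i<N. (v i)\<^sup>2 / (2 * \<sigma>\<^sup>2))"
        by (rule gauss_two_point[OF pos(3) finite_lessThan F_meas F_meas FF])
      also have "(\<lambda>w. F S (\<lambda>i\<in>{..<N}. v i + w i)) = (\<lambda>Ws. G S (x, Xs, Ws))"
        using x(1) by (simp add: fun_eq_iff F_def G_def dat_def mv cong: restrict_cong)
      also have "(\<lambda>w. F ?T (\<lambda>i\<in>{..<N}. - v i + w i)) = (\<lambda>Ws. G ?T (x, Xs, Ws))"
        using x(1) by (simp add: fun_eq_iff F_def G_def dat_def mv cong: restrict_cong)
      also have "ennreal (\<Sum>i<N. (v i)\<^sup>2 / (2 * \<sigma>\<^sup>2)) = (\<Sum>i<N. ennreal ((v i)\<^sup>2 / (2 * \<sigma>\<^sup>2)))"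
        by (rule sum_ennreal[symmetric]) simp
      also have "\<dots> \<le> (\<Sum>i<N. ennreal (if cell h V (Xs i) = cell h V x then A\<^sup>2 / (8 * \<sigma>\<^sup>2) else 0))"
      proof (intro sum_mono ennreal_leI)
        fix i
        have "(\<eta> S (Xs i))\<^sup>2 \<le> (A / 2)\<^sup>2"
          using abs_hyp_le[OF A, of h V S "Xs i"] A unfolding \<eta>_def by (subst abs_le_square_iff[symmetric]) auto
        then show "(v i)\<^sup>2 / (2 * \<sigma>\<^sup>2) \<le> (if cell h V (Xs i) = cell h V x then A\<^sup>2 / (8 * \<sigma>\<^sup>2) else 0)"
          using pos(3) by (simp add: v_def T power_divide field_simps)
      qed
      finally show ?thesis by (simp add: add_left_mono)
    qed
  qed (use small in \<open>simp_all add: A_def\<close>)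
  have attack: "\<exists>a\<in>attacks N q. \<exists>b\<in>attacks N q. G S (x, Xs, Ws)
      \<le> err e \<delta> (\<eta> S) (obs (\<eta> S) N Xs Ws (fst a) (snd a)) x
       + err e \<delta> (\<eta> S) (obs (\<eta> S) N Xs Ws (fst b) (snd b)) x" if "x \<in> X" for S x Xs Ws
    using that
    by (intro bexI[OF _ attacks_trivial]) (simp add: G_def obs_def dat_def)
  have outside: "G S (x, y) = 0" if "x \<notin> X" for S x y
    using that by (cases y) (simp add: G_def)
  show "ennreal ((L * h / K / 4)\<^sup>2 / (16 * 2 ^ DIM('a))) \<le> worst_pt_risk e N q"
    by (rule worst_risk_ge(1)[OF h noise V G_meas outside attack[unfolded \<eta>_def A_def \<delta>_def] pair])
  show "ennreal (L * h / K / 4 / (16 * 2 ^ DIM('a))) \<le> worst_sup_risk e N q"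
    by (rule worst_risk_ge(2)[OF h noise V G_meas outside attack[unfolded \<eta>_def A_def \<delta>_def] pair])
qed

text \<open>Uniform noise on an interval of length \<open>\<sigma>\<close>;
  \<open>L * h / K \<le> \<sigma>\<close> keeps every shift within one period. A label in the
  flipped cell wraps with probability at most \<open>A / \<sigma>\<close>, and Markov's inequality
  against the budget divides by \<open>q\<close>, which explains the form of
  \<open>small\<close>.\<close>

lemma attacked_data_bound:
  fixes N q :: nat
  assumes e: "is_estimator N e" and h: "0 < h" "L * h / K \<le> 2 * M" "L * h / K \<le> \<sigma>" and q: "0 < q"
    and small: "L * h / K / (\<sigma> * q) * real N * h ^ DIM('a) / vol \<le> 1 / 2"
  shows "ennreal ((L * h / K / 4)\<^sup>2 / (16 * 2 ^ DIM('a))) \<le> worst_pt_risk e N q"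
    and "ennreal (L * h / K / 4 / (16 * 2 ^ DIM('a))) \<le> worst_sup_risk e N q"
proof -
  define A where "A = L * h / K"
  define \<delta> where "\<delta> = L * h / K / 4"
  define a where "a = \<sigma> / 2"
  have a: "0 < a" using pos by (simp add: a_def)
  have A: "0 \<le> A" "A \<le> 2 * a" using h pos by (simp_all add: A_def a_def)
  have noise: "subgaussian_noise \<sigma> (unif a)" unfolding a_def by (rule subgaussian_noise_unif) (rule pos)
  then have \<gamma>: "prob_space (unif a)" by (simp add: subgaussian_noise_def)
  obtain V where V: "ennreal (1 / 2 ^ DIM('a)) \<le> emeasure P {x\<in>X. 1 / 4 \<le> bump h V x}"
    using exists_good_grid[OF prob_space_P sets_P X_borel emeasure_P_X(1) h(1)] by blast
  define \<eta> where "\<eta> = hyp A h V"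
  have [measurable]: "\<eta> S \<in> borel_measurable borel" for S
    unfolding \<eta>_def by (rule borel_measurable_hyp[OF h(1) A(1)])
  have abs_\<eta>: "\<bar>\<eta> S y\<bar> \<le> A / 2" for S y unfolding \<eta>_def by (rule abs_hyp_le[OF A(1)])
  define dat where "dat S Xs Ws = (\<lambda>i\<in>{..<N}. (Xs i, \<eta> S (Xs i) + Ws i))" for S Xs and Ws :: "nat \<Rightarrow> real"
  text \<open>\<open>fake\<close> is the data of an adversary who makes hypothesis \<open>S\<close> look like its flip at the
    cell of \<open>x\<close>; labels without \<open>wrap\<close> stay untouched.\<close>
  define gap where "gap S x y = (if cell h V y = cell h V x then 2 * \<eta> S y else 0)" for S x y
  define wrap where "wrap S x Xs Ws i \<longleftrightarrow> rot a (gap S x (Xs i)) (Ws i) \<noteq> gap S x (Xs i) + Ws i" for S x Xs Ws and i :: nat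
  define cnt where "cnt S x Xs Ws = (\<Sum>i<N. if wrap S x Xs Ws i then 1 else 0 :: real)" for S x Xs Ws
  define fake where "fake S x Xs Ws =
      (\<lambda>i\<in>{..<N}. (Xs i, \<eta> S (Xs i) - gap S x (Xs i) + rot a (gap S x (Xs i)) (Ws i)))" for S x Xs Ws
  \<comment> \<open>The error under the forged data counts only if the forgery alters at most
    \<open>q\<close> labels.\<close>
  define att where "att S x Xs Ws = (if cnt S x Xs Ws \<le> q then err e \<delta> (\<eta> S) (fake S x Xs Ws) x else 0)" for S x Xs Ws
  define unatt where "unatt S x Xs Ws = err e \<delta> (\<eta> S) (dat S Xs Ws) x" for S x Xs Ws
  \<comment> \<open>In a pair one hypothesis is attacked and its flip is not. Adding both errors
    lets the same \<open>G\<close> play either role, as averaging over all \<open>S\<close>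
    requires.\<close>
  define G where "G S = (\<lambda>(x, Xs, Ws). indicator X x * (att S x Xs Ws + unatt S x Xs Ws))" for S
  let ?U = "PiM {..<N} (\<lambda>_. unif a)"
  have G_meas: "G S \<in> borel_measurable (sample_space f0 (\<lambda>_. unif a) N)" for S
  proof -
    let ?M = "P \<Otimes>\<^sub>M PiM {..<N} (\<lambda>_. P) \<Otimes>\<^sub>M ?U"
    have "(\<lambda>\<omega>. fake S (fst \<omega>) (fst (snd \<omega>)) (snd (snd \<omega>))) \<in> ?M \<rightarrow>\<^sub>M PiM {..<N} (\<lambda>_. borel)"
      unfolding fake_def gap_def by measurable
    note fake_meas = this
    have err_meas: "(\<lambda>\<omega>. err e \<delta> (\<eta> S) (fake S (fst \<omega>) (fst (snd \<omega>)) (snd (snd \<omega>))) (fst \<omega>)) \<in> borel_measurable ?M"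
      by (rule borel_measurable_err[OF e _ fake_meas]) measurable
    have unatt_meas: "(\<lambda>\<omega>. unatt S (fst \<omega>) (fst (snd \<omega>)) (snd (snd \<omega>))) \<in> borel_measurable ?M"
      unfolding unatt_def dat_def by (rule borel_measurable_err[OF e]) measurable
    have cnt_meas: "(\<lambda>\<omega>. cnt S (fst \<omega>) (fst (snd \<omega>)) (snd (snd \<omega>))) \<in> borel_measurable ?M"
      unfolding cnt_def wrap_def
    proof (intro borel_measurable_sum measurable_If)
      fix i assume [measurable]: "i \<in> {..<N}"
      let ?g = "\<lambda>\<omega>. gap S (fst \<omega>) (fst (snd \<omega>) i)"
      have g [measurable]: "?g \<in> borel_measurable ?M" unfolding gap_def by measurable
      have w: "(\<lambda>\<omega>. snd (snd \<omega>) i) \<in> borel_measurable ?M" by measurable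
      show "{\<omega> \<in> space ?M. rot a (?g \<omega>) (snd (snd \<omega>) i) \<noteq> ?g \<omega> + snd (snd \<omega>) i} \<in> sets ?M"
        by (rule borel_measurable_neq[OF measurable_rot[OF g w] borel_measurable_add[OF g w]])
    qed simp_all
    have att_meas: "(\<lambda>\<omega>. att S (fst \<omega>) (fst (snd \<omega>)) (snd (snd \<omega>))) \<in> borel_measurable ?M"
      unfolding att_def by (intro measurable_If err_meas borel_measurable_le[OF cnt_meas]) auto
    show ?thesis
      unfolding G_def sample_space_eq Q_def split_beta'
      by (intro borel_measurable_times_ennreal borel_measurable_add att_meas unatt_meas) measurable
  qed
  have pair: "ennreal (1/4) \<le> (\<integral>\<^sup>+ y. G S (x, y) \<partial>Q (unif a) N)
      + (\<integral>\<^sup>+ y. G (flip (cell h V x) S) (x, y) \<partial>Q (unif a) N)"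
    if x: "x \<in> X" "1 / 4 \<le> bump h V x" for x S
  \<comment> \<open>The rotation makes the two laws coincide exactly, hence \<open>t = 1\<close>;
    the only loss is that the attack may exceed its budget.\<close>
  proof (rule pair_bound[where t=1 and c="A / (\<sigma> * q)", OF \<gamma> h(1) _ G_meas G_meas])
    let ?T = "flip (cell h V x) S"
    have T: "\<eta> ?T y = \<eta> S y - gap S x y" for y
      unfolding \<eta>_def gap_def by (simp add: hyp_flip)
    have sep: "2 * \<delta> \<le> \<bar>\<eta> S x - \<eta> ?T x\<bar>"
    proof -
      have "A * (1 / 4) \<le> A * bump h V x" using A(1) x(2) by (rule mult_left_mono[rotated])
      then show ?thesis using abs_hyp[OF A(1), of h V S x] unfolding T by (simp add: gap_def \<eta>_def \<delta>_def A_def)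
    qed
    show "ennreal 1 \<le> (\<integral>\<^sup>+ Ws. G S (x, Xs, Ws) \<partial>?U) + (\<integral>\<^sup>+ Ws. G ?T (x, Xs, Ws) \<partial>?U)
      + (\<Sum>i<N. ennreal (if cell h V (Xs i) = cell h V x then A / (\<sigma> * q) else 0))" for Xs
    proof -
      define s where "s i = gap S x (Xs i)" for i
      have s: "\<bar>s i\<bar> \<le> (if cell h V (Xs i) = cell h V x then A else 0)" for i
        using abs_\<eta>[of S "Xs i"] by (simp add: s_def gap_def abs_mult)
      have s_le: "\<bar>s i\<bar> \<le> 2 * a" for i
        using s[of i] A by (auto split: if_splits)
      define H where "H w = err e \<delta> (\<eta> S) (dat ?T Xs w) x" for w
      have [measurable]: "H \<in> borel_measurable ?U"
        unfolding H_def dat_def by (rule borel_measurable_err[OF e]) measurable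
      have [measurable]: "unatt ?T x Xs \<in> borel_measurable ?U"
        unfolding unatt_def dat_def by (rule borel_measurable_err[OF e]) measurable
      have [measurable]: "cnt S x Xs \<in> borel_measurable ?U"
        unfolding cnt_def wrap_def s_def[symmetric] by measurable
      have fake_eq: "err e \<delta> (\<eta> S) (fake S x Xs w) x = H (\<lambda>i\<in>{..<N}. rot a (s i) (w i))" for w
        by (simp add: H_def fake_def dat_def T s_def cong: restrict_cong)
      have [measurable]: "(\<lambda>w. H (\<lambda>i\<in>{..<N}. rot a (s i) (w i))) \<in> borel_measurable ?U"
        by measurable
      have [measurable]: "att S x Xs \<in> borel_measurable ?U"
        unfolding att_def fake_eq by measurable
      let ?Z = "\<lambda>i. {w. rot a (s i) w \<noteq> s i + w}"
      have Z [measurable]: "?Z i \<in> sets borel" for i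
      proof -
        have "Measurable.pred borel (\<lambda>w. rot a (s i) w \<noteq> s i + w)" by measurable
        then show ?thesis by (simp add: pred_def)
      qed
      have cnt_eq: "ennreal (cnt S x Xs w / q) = (\<Sum>i<N. ennreal (1 / q) * indicator (?Z i) (w i))" for w
      proof -
        have "cnt S x Xs w / q = (\<Sum>i<N. 1 / q * indicator (?Z i) (w i))"
          by (auto simp: cnt_def wrap_def s_def indicator_def sum_divide_distrib intro!: sum.cong)
        then have "ennreal (cnt S x Xs w / q) = ennreal (\<Sum>i<N. 1 / q * indicator (?Z i) (w i))"
          by (simp only:)
        also have "\<dots> = (\<Sum>i<N. ennreal (1 / q * indicator (?Z i) (w i)))"
          by (rule sum_ennreal[symmetric]) simp
        also have "\<dots> = (\<Sum>i<N. ennreal (1 / q) * indicator (?Z i) (w i))"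
          by (intro sum.cong refl) (simp add: indicator_def)
        finally show ?thesis .
      qed
      have "(\<integral>\<^sup>+ w. ennreal (cnt S x Xs w / q) \<partial>?U) = (\<Sum>i<N. \<integral>\<^sup>+ w. ennreal (1 / q) * indicator (?Z i) (w i) \<partial>?U)"
        unfolding cnt_eq by (rule nn_integral_sum) measurable
      also have "\<dots> = (\<Sum>i<N. \<integral>\<^sup>+ w. ennreal (1 / q) * indicator (?Z i) w \<partial>unif a)"
        by (intro sum.cong refl nn_integral_PiM_component[OF \<gamma>]) measurable
      also have "\<dots> = (\<Sum>i<N. ennreal (1 / q) * emeasure (unif a) (?Z i))"
        by (intro sum.cong refl nn_integral_cmult_indicator) (simp add: Z)
      also have "\<dots> \<le> (\<Sum>i<N. ennreal (1 / q) * ennreal (\<bar>s i\<bar> / (2 * a)))"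
        by (intro sum_mono mult_left_mono emeasure_unif_wrap a) auto
      also have "\<dots> \<le> (\<Sum>i<N. ennreal (if cell h V (Xs i) = cell h V x then A / (\<sigma> * q) else 0))"
      proof (rule sum_mono)
        fix i
        have "1 / q * (\<bar>s i\<bar> / (2 * a)) \<le> (if cell h V (Xs i) = cell h V x then A / (\<sigma> * q) else 0)"
        proof -
          have "1 / q * (\<bar>s i\<bar> / (2 * a)) = \<bar>s i\<bar> / (\<sigma> * q)"
            by (simp add: a_def mult.commute)
          also have "\<dots> \<le> (if cell h V (Xs i) = cell h V x then A else 0) / (\<sigma> * q)"
            using pos by (intro divide_right_mono s) simp
          finally show ?thesis by (simp split: if_splits)
        qed
        then have le: "ennreal (1 / q * (\<bar>s i\<bar> / (2 * a))) \<le> ennreal (if cell h V (Xs i) = cell h V x then A / (\<sigma> * q) else 0)"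
          by (rule ennreal_leI)
        have "ennreal (1 / q) * ennreal (\<bar>s i\<bar> / (2 * a)) = ennreal (1 / q * (\<bar>s i\<bar> / (2 * a)))"
          using a by (intro ennreal_mult[symmetric]) auto
        then show "ennreal (1 / q) * ennreal (\<bar>s i\<bar> / (2 * a)) \<le> ennreal (if cell h V (Xs i) = cell h V x then A / (\<sigma> * q) else 0)"
          using le by (simp only:)
      qed
      finally have cnt_le: "(\<integral>\<^sup>+ w. ennreal (cnt S x Xs w / q) \<partial>?U)
        \<le> (\<Sum>i<N. ennreal (if cell h V (Xs i) = cell h V x then A / (\<sigma> * q) else 0))" .
      interpret U: prob_space ?U by (intro prob_space_PiM \<gamma>)
      have "ennreal 1 = (\<integral>\<^sup>+ w. 1 \<partial>?U)" using U.emeasure_space_1 by simp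
      also have "\<dots> \<le> (\<integral>\<^sup>+ w. H w + unatt ?T x Xs w \<partial>?U)"
        unfolding H_def unatt_def by (intro nn_integral_mono err_two_point[where \<eta>="\<eta> S" and \<eta>'="\<eta> ?T" and x=x, OF sep])
      also have "\<dots> = (\<integral>\<^sup>+ w. H w \<partial>?U) + (\<integral>\<^sup>+ w. unatt ?T x Xs w \<partial>?U)"
        by (rule nn_integral_add) measurable
      \<comment> \<open>Rotated noise has the same law, so the clean error under the flip may be
        evaluated on the forged data.\<close>
      also have "(\<integral>\<^sup>+ w. H w \<partial>?U) = (\<integral>\<^sup>+ w. H (\<lambda>i\<in>{..<N}. rot a (s i) (w i)) \<partial>?U)"
        by (rule nn_integral_PiM_unif_rot[OF a finite_lessThan s_le, symmetric]) measurable
      also have "\<dots> \<le> (\<integral>\<^sup>+ w. att S x Xs w + ennreal (cnt S x Xs w / q) \<partial>?U)"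
      proof (rule nn_integral_mono)
        fix w
        show "H (\<lambda>i\<in>{..<N}. rot a (s i) (w i)) \<le> att S x Xs w + ennreal (cnt S x Xs w / q)"
        proof (cases "cnt S x Xs w \<le> q")
          \<comment> \<open>Markov's inequality in pointwise form: beyond the budget
            \<open>cnt / q\<close> exceeds 1, which bounds the error.\<close>
          case False
          then have "ennreal 1 \<le> ennreal (cnt S x Xs w / q)" using q by (intro ennreal_leI) simp
          then have "H (\<lambda>i\<in>{..<N}. rot a (s i) (w i)) \<le> ennreal (cnt S x Xs w / q)"
            unfolding H_def by (intro order_trans[OF err_le_1]) simp
          then show ?thesis using False by (simp add: att_def)
        qed (simp add: att_def fake_eq)
      qed
      also have "\<dots> = (\<integral>\<^sup>+ w. att S x Xs w \<partial>?U) + (\<integral>\<^sup>+ w. ennreal (cnt S x Xs w / q) \<partial>?U)"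
        by (rule nn_integral_add) measurable
      finally have "ennreal 1 \<le> (\<integral>\<^sup>+ w. att S x Xs w \<partial>?U) + (\<integral>\<^sup>+ w. ennreal (cnt S x Xs w / q) \<partial>?U)
          + (\<integral>\<^sup>+ w. unatt ?T x Xs w \<partial>?U)"
        by (simp add: add_right_mono)
      also have "\<dots> \<le> (\<integral>\<^sup>+ w. G S (x, Xs, w) \<partial>?U)
          + (\<Sum>i<N. ennreal (if cell h V (Xs i) = cell h V x then A / (\<sigma> * q) else 0))
          + (\<integral>\<^sup>+ w. G ?T (x, Xs, w) \<partial>?U)"
        using x(1) by (intro add_mono cnt_le nn_integral_mono) (auto simp: G_def)
      finally show ?thesis by (simp add: ac_simps)
    qed
    show "0 \<le> A / (\<sigma> * q)" using A pos by simp
    have "A / (\<sigma> * q) * real N * h ^ DIM('a) / vol \<le> 1 / 2" using small by (simp only: A_def)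
    then show "A / (\<sigma> * q) * real N * h ^ DIM('a) / vol \<le> 1 - 1 / 4" by linarith
  qed simp
  have attack: "\<exists>a\<in>attacks N q. \<exists>b\<in>attacks N q. G S (x, Xs, Ws)
      \<le> err e \<delta> (\<eta> S) (obs (\<eta> S) N Xs Ws (fst a) (snd a)) x
       + err e \<delta> (\<eta> S) (obs (\<eta> S) N Xs Ws (fst b) (snd b)) x" if "x \<in> X" for S x Xs Ws
  proof -
    have unatt: "unatt S x Xs Ws = err e \<delta> (\<eta> S) (obs (\<eta> S) N Xs Ws (fst ({}, \<lambda>_. 0)) (snd ({}, \<lambda>_. 0))) x"
      by (simp add: unatt_def dat_def obs_def)
    have "\<exists>a\<in>attacks N q. att S x Xs Ws \<le> err e \<delta> (\<eta> S) (obs (\<eta> S) N Xs Ws (fst a) (snd a)) x"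
    proof (cases "cnt S x Xs Ws \<le> q")
      case True
      \<comment> \<open>Where the noise does not wrap, subtracting the gap cancels the shift and the
        forged label is the true one, so only the labels in \<open>?B\<close> are replaced.\<close>
      let ?B = "{i\<in>{..<N}. wrap S x Xs Ws i}"
      let ?z = "\<lambda>i. \<eta> S (Xs i) - gap S x (Xs i) + rot a (gap S x (Xs i)) (Ws i)"
      have "cnt S x Xs Ws = card ?B"
        by (simp add: cnt_def sum.If_cases Int_def)
      then have "(?B, ?z) \<in> attacks N q"
        using True by (auto simp: attacks_def)
      moreover have "obs (\<eta> S) N Xs Ws ?B ?z = fake S x Xs Ws"
        by (auto simp: obs_def fake_def wrap_def fun_eq_iff restrict_def)
      ultimately show ?thesis
        using True by (intro bexI[of _ "(?B, ?z)"]) (simp_all add: att_def)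
    next
      case False
      then show ?thesis using attacks_trivial by (auto simp: att_def)
    qed
    then obtain b where b: "b \<in> attacks N q" "att S x Xs Ws \<le> err e \<delta> (\<eta> S) (obs (\<eta> S) N Xs Ws (fst b) (snd b)) x"
      by blast
    show ?thesis
    proof (intro bexI)
      show "G S (x, Xs, Ws) \<le> err e \<delta> (\<eta> S) (obs (\<eta> S) N Xs Ws (fst b) (snd b)) x
        + err e \<delta> (\<eta> S) (obs (\<eta> S) N Xs Ws (fst ({}, \<lambda>_. 0)) (snd ({}, \<lambda>_. 0))) x"
        using that b(2) unatt by (simp add: G_def add_mono)
    qed (use b(1) attacks_trivial in auto)
  qed
  have outside: "G S (x, y) = 0" if "x \<notin> X" for S x y
    using that by (cases y) (simp add: G_def)
  show "ennreal ((L * h / K / 4)\<^sup>2 / (16 * 2 ^ DIM('a))) \<le> worst_pt_risk e N q"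
    by (rule worst_risk_ge(1)[OF h(1,2) noise V G_meas outside attack[unfolded \<eta>_def A_def \<delta>_def] pair])
  show "ennreal (L * h / K / 4 / (16 * 2 ^ DIM('a))) \<le> worst_sup_risk e N q"
    by (rule worst_risk_ge(2)[OF h(1,2) noise V G_meas outside attack[unfolded \<eta>_def A_def \<delta>_def] pair])
qed

text \<open>Cell widths \<open>c0 * r\<close> and \<open>c0 * p\<close> are proportional to the two
  rates. As \<open>r\<close> solves \<open>N * r ^ (d + 2) = 1\<close> and \<open>p\<close> solves
  \<open>N * p ^ (d + 1) = q\<close>, the smallness conditions reduce to bounds on \<open>c0\<close>
  free of \<open>N\<close> and \<open>q\<close>.\<close>

lemma minimax_lower_bounds:
  shows "\<exists>c>0. \<forall>N q e. 1 \<le> N \<longrightarrow> q \<le> N \<longrightarrow> is_estimator N e \<longrightarrow>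
     worst_pt_risk e N q \<ge> ennreal (c * ((real q / real N) powr ((real DIM('a) + 2) / (real DIM('a) + 1))
                        + real N powr (- 2 / (real DIM('a) + 2))))
     \<and> worst_sup_risk e N q \<ge> ennreal (c * ((real q / real N) powr (1 / (real DIM('a) + 1))
                        + real N powr (- 1 / (real DIM('a) + 2))))"
proof -
  let ?d = "DIM('a)"
  \<comment> \<open>In order, the entries make powers of \<open>c0\<close> at most
    \<open>c0\<close>, keep the functions within \<open>M\<close>, keep the shift within
    \<open>\<sigma>\<close>, and give the smallness conditions for clean and for attacked
    data.\<close>
  define c0 where "c0 = Min {1, 2 * M * K / L, \<sigma> * K / L, 2 * K\<^sup>2 * vol * \<sigma>\<^sup>2 / L\<^sup>2, K * \<sigma> * vol / (2 * L)}"
  have c0: "0 < c0" "c0 \<le> 1" "c0 \<le> 2 * M * K / L" "c0 \<le> \<sigma> * K / L"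
    "c0 \<le> 2 * K\<^sup>2 * vol * \<sigma>\<^sup>2 / L\<^sup>2" "c0 \<le> K * \<sigma> * vol / (2 * L)"
    using pos vol_pos by (auto simp: c0_def)
  define \<delta>0 where "\<delta>0 = L * c0 / K / 4"
  have \<delta>0: "0 < \<delta>0" using c0 pos by (simp add: \<delta>0_def)
  define C1 where "C1 = \<delta>0\<^sup>2 / (16 * 2 ^ ?d)"
  define C2 where "C2 = \<delta>0 / (16 * 2 ^ ?d)"
  have C: "0 < C1" "0 < C2" using \<delta>0 by (simp_all add: C1_def C2_def)
  have h_ok: "L * (c0 * r) / K \<le> 2 * M" "L * (c0 * r) / K \<le> \<sigma>" if "0 \<le> r" "r \<le> 1" for r
  proof -
    have "c0 * r \<le> c0 * 1" using that c0 by (intro mult_left_mono) auto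
    then have "c0 * r \<le> 2 * M * K / L" "c0 * r \<le> \<sigma> * K / L" using c0 by linarith+
    then show "L * (c0 * r) / K \<le> 2 * M" "L * (c0 * r) / K \<le> \<sigma>"
      using pos by (simp_all add: field_simps)
  qed
  have c0_pow: "c0 ^ Suc n \<le> c0" for n
    using c0 power_decreasing[of 1 "Suc n" c0] by simp
  have risk_eq: "(L * (c0 * r) / K / 4)\<^sup>2 / (16 * 2 ^ ?d) = C1 * r\<^sup>2"
    "L * (c0 * r) / K / 4 / (16 * 2 ^ ?d) = C2 * r" for r
    by (simp_all add: C1_def C2_def \<delta>0_def power_mult_distrib power_divide)
  \<comment> \<open>The larger of two lower bounds is at least half of their sum.\<close>
  have combine: "ennreal (min C1 C2 / 2 * (p + p')) \<le> W"
    if "ennreal (C' * p) \<le> W" "ennreal (C' * p') \<le> W" "0 \<le> p" "0 \<le> p'" "min C1 C2 \<le> C'" for C' p p' W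
  proof -
    have "min C1 C2 * (p + p') \<le> C' * (p + p')"
      using that by (intro mult_right_mono) auto
    then have "min C1 C2 / 2 * (p + p') \<le> C' * p \<or> min C1 C2 / 2 * (p + p') \<le> C' * p'"
      unfolding distrib_left by linarith
    then show ?thesis using that by (auto intro: order_trans[OF ennreal_leI])
  qed
  show ?thesis
  proof (intro exI[of _ "min C1 C2 / 2"] conjI allI impI)
    show "0 < min C1 C2 / 2" using C by simp
    fix N q :: nat and e :: "(nat \<Rightarrow> 'a \<times> real) \<Rightarrow> 'a \<Rightarrow> real"
    assume N: "1 \<le> N" and q: "q \<le> N" and e: "is_estimator N e"
    define r where "r = real N powr (- 1 / (real ?d + 2))"
    have "r \<le> real N powr 0" unfolding r_def using N by (intro powr_mono) auto
    then have r: "0 < r" "r \<le> 1" using N by (auto simp: r_def)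
    have rN: "real N * r ^ (?d + 2) = 1"
    proof -
      have "r ^ (?d + 2) = r powr real (?d + 2)" using r(1) by (rule powr_realpow[symmetric])
      also have "\<dots> = real N powr (- 1 / (real ?d + 2) * real (?d + 2))" unfolding r_def by (rule powr_powr)
      also have "- 1 / (real ?d + 2) * real (?d + 2) = - 1" by (simp add: field_simps)
      finally have "r ^ (?d + 2) = real N powr (- 1)" .
      then show ?thesis using N by (simp add: powr_minus)
    qed
    have "(L * (c0 * r) / K)\<^sup>2 / (8 * \<sigma>\<^sup>2) * real N * (c0 * r) ^ ?d / vol
        = L\<^sup>2 / (8 * K\<^sup>2 * \<sigma>\<^sup>2 * vol) * c0 ^ Suc (Suc ?d) * (real N * r ^ (?d + 2))"
      by (simp add: power_mult_distrib power_divide power2_eq_square field_simps)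
    also have "\<dots> \<le> L\<^sup>2 / (8 * K\<^sup>2 * \<sigma>\<^sup>2 * vol) * c0"
      unfolding rN mult_1_right using pos vol_pos by (intro mult_left_mono c0_pow) auto
    also have "\<dots> \<le> L\<^sup>2 / (8 * K\<^sup>2 * \<sigma>\<^sup>2 * vol) * (2 * K\<^sup>2 * vol * \<sigma>\<^sup>2 / L\<^sup>2)"
      using pos vol_pos c0 by (intro mult_left_mono) auto
    also have "\<dots> = 1 / 4" using pos vol_pos by (simp add: field_simps)
    finally have small: "(L * (c0 * r) / K)\<^sup>2 / (8 * \<sigma>\<^sup>2) * real N * (c0 * r) ^ ?d / vol \<le> 1 / 4" .
    have h: "0 < c0 * r" using c0 r by simp
    have h1: "L * (c0 * r) / K \<le> 2 * M" using r by (intro h_ok) auto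
    have clean: "ennreal (C1 * r\<^sup>2) \<le> worst_pt_risk e N q" "ennreal (C2 * r) \<le> worst_sup_risk e N q"
      using clean_data_bound[OF e h h1 small] by (simp_all only: risk_eq)
    define p where "p = (real q / real N) powr (1 / (real ?d + 1))"
    have p: "0 \<le> p" "p \<le> 1" using N q by (auto simp: p_def intro!: powr_le1)
    have attacked: "ennreal (C1 * p\<^sup>2) \<le> worst_pt_risk e N q \<and> ennreal (C2 * p) \<le> worst_sup_risk e N q"
    \<comment> \<open>For \<open>q = 0\<close> the rate \<open>p\<close> is 0 and both bounds are
      trivial.\<close>
    proof (cases "q = 0")
      case False
      have p': "0 < p" using False N by (simp add: p_def)
      have "p ^ (?d + 1) = p powr real (?d + 1)" using p' by (rule powr_realpow[symmetric])
      also have "\<dots> = (real q / real N) powr (1 / (real ?d + 1) * real (?d + 1))"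
        unfolding p_def by (rule powr_powr)
      also have "1 / (real ?d + 1) * real (?d + 1) = 1" by (simp add: field_simps)
      finally have "p ^ (?d + 1) = real q / real N" using False N by simp
      then have pN: "real N * p ^ (?d + 1) = real q" using N by simp
      have "L * (c0 * p) / K / (\<sigma> * q) * real N * (c0 * p) ^ ?d / vol
          = L / (K * \<sigma> * vol * q) * c0 ^ Suc ?d * (real N * p ^ (?d + 1))"
        by (simp add: power_mult_distrib field_simps)
      also have "\<dots> = L / (K * \<sigma> * vol) * c0 ^ Suc ?d"
        unfolding pN using False by simp
      also have "\<dots> \<le> L / (K * \<sigma> * vol) * c0"
        using pos vol_pos by (intro mult_left_mono c0_pow) auto
      also have "\<dots> \<le> L / (K * \<sigma> * vol) * (K * \<sigma> * vol / (2 * L))"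
        using pos vol_pos c0 by (intro mult_left_mono) auto
      also have "\<dots> = 1 / 2" using pos vol_pos by (simp add: field_simps)
      finally have small: "L * (c0 * p) / K / (\<sigma> * q) * real N * (c0 * p) ^ ?d / vol \<le> 1 / 2" .
      have h: "0 < c0 * p" using c0 p' by simp
      show ?thesis
        using attacked_data_bound[OF e h h_ok[OF p] _ small] False by (simp only: risk_eq)
    qed (simp add: p_def)
    \<comment> \<open>As \<open>q / N \<le> 1\<close>, the smaller exponent
      \<open>2 / (d + 1)\<close> gives the larger power: knowing the test point, the adversary
      achieves more than the claimed rate.\<close>
    have p_le: "(real q / real N) powr ((real ?d + 2) / (real ?d + 1)) \<le> p\<^sup>2"
    proof (cases "q = 0")
      case False
      have "p\<^sup>2 = (real q / real N) powr (2 / (real ?d + 1))"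
        using False N by (simp add: p_def powr_realpow[symmetric] powr_powr)
      moreover have "(real q / real N) powr ((real ?d + 2) / (real ?d + 1)) \<le> (real q / real N) powr (2 / (real ?d + 1))"
        using False N q by (intro powr_mono') (auto intro!: divide_right_mono)
      ultimately show ?thesis by simp
    qed simp
    have r2: "real N powr (- 2 / (real ?d + 2)) = r\<^sup>2"
      using N by (simp add: r_def powr_realpow[symmetric] powr_powr)
    have "ennreal (C1 * (real q / real N) powr ((real ?d + 2) / (real ?d + 1))) \<le> worst_pt_risk e N q"
      using C p_le by (intro order_trans[OF ennreal_leI attacked[THEN conjunct1]] mult_left_mono) auto
    from combine[OF this clean(1)]
    show "worst_pt_risk e N q \<ge> ennreal (min C1 C2 / 2 * ((real q / real N) powr ((real ?d + 2) / (real ?d + 1))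
                        + real N powr (- 2 / (real ?d + 2))))"
      unfolding r2 by simp
    from combine[OF attacked[THEN conjunct2] clean(2)] p r
    show "worst_sup_risk e N q \<ge> ennreal (min C1 C2 / 2 * ((real q / real N) powr (1 / (real ?d + 1))
                        + real N powr (- 1 / (real ?d + 2))))"
      unfolding r_def[symmetric] p_def[symmetric] by simp
  qed
qed

end

theorem theorem3:
  fixes nrm :: "'a::euclidean_space \<Rightarrow> real" and X :: "'a set"
    and L fm fM D \<alpha> \<sigma> M :: real
  assumes "is_norm nrm" "compact X"
    and "0 < L" "0 < fm" "0 < D" "0 < \<alpha>" "0 < \<sigma>" "0 < M"
    and "regular_domain nrm X \<alpha> D"
    and "fm * measure lborel X \<le> 1" "1 \<le> fM * measure lborel X"
  shows "\<exists>c>0. \<forall>N q (e :: (nat \<Rightarrow> 'a \<times> real) \<Rightarrow> 'a \<Rightarrow> real).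
     1 \<le> N \<longrightarrow> q \<le> N \<longrightarrow> is_estimator N e \<longrightarrow>
       (SUP t\<in>{(f, \<eta>, \<mu>). in_class nrm X L fm fM M \<sigma> N f \<eta> \<mu>}.
          \<integral>\<^sup>+ \<omega>. pt_risk e (fst (snd t)) N q \<omega> \<partial>sample_space (fst t) (snd (snd t)) N)
        \<ge> ennreal (c * ((real q / real N) powr ((real DIM('a) + 2) / (real DIM('a) + 1))
                        + real N powr (- 2 / (real DIM('a) + 2))))
     \<and> (SUP t\<in>{(f, \<eta>, \<mu>). in_class nrm X L fm fM M \<sigma> N f \<eta> \<mu>}.
          \<integral>\<^sup>+ \<omega>. sup_risk e (fst (snd t)) X N q \<omega> \<partial>sample_space (fst t) (snd (snd t)) N)
        \<ge> ennreal (c * ((real q / real N) powr (1 / (real DIM('a) + 1))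
                        + real N powr (- 1 / (real DIM('a) + 2))))"
proof -
  obtain K where K: "0 < K" "\<And>z b. b \<in> Basis \<Longrightarrow> \<bar>z \<bullet> b\<bar> \<le> K * nrm z"
    using is_norm_dominates_coords[OF assms(1)] by blast
  interpret regression_class nrm X L fm fM \<sigma> M K
    by unfold_locales (use assms K in auto)
  show ?thesis
    using minimax_lower_bounds unfolding worst_pt_risk_def worst_sup_risk_def .
qed

end
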